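(* Every Spherical Diagram has at least two clockwise swirls and at least two counterclockwise swirls.
   Context: A geodesic arc on the unit sphere in $\mathbb R^3$ is the unique shortest curve joining two non-antipodal points. An arc $a$ blocks an arc $b$ (equivalently, $b$ hits $a$) if an endpoint of $b$ lies in the relative interior of $a$. A Spherical Diagram (SD) is a finite non-empty collection $\mathcal D$ of pairwise interior-disjoint geodesic arcs on the unit sphere such that each arc of $\mathcal D$ is blocked by arcs of $\mathcal D$ at each of its endpoints. A swirl of an SD is a cycle of arcs $a_1,\dots,a_d$ of the SD such that each $a_i$ hits $a_{i+1}$ (indices modulo $d$), the cycle going either all clockwise (a clockwise swirl) or all counterclockwise (a counterclockwise swirl); $d$ is its degree. *)

theory Defs
  imports "HOL-Analysis.Analysis"
begin

type_synonym point = "real^3"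
type_synonym arc = "point \<times> point"

definition on_sphere :: "point \<Rightarrow> bool" where
  "on_sphere p \<longleftrightarrow> norm p = 1"

definition is_arc :: "arc \<Rightarrow> bool" where
  "is_arc a \<longleftrightarrow> on_sphere (fst a) \<and> on_sphere (snd a) \<and> fst a \<noteq> snd a \<and> fst a \<noteq> - snd a"

definition endpoints :: "arc \<Rightarrow> point set" where
  "endpoints a = {fst a, snd a}"

text \<open>Points of the (closed) shortest geodesic arc: radial projection of the chord.\<close>
definition arc_points :: "arc \<Rightarrow> point set" where
  "arc_points a = {sgn ((1 - t) *\<^sub>R fst a + t *\<^sub>R snd a) | t. 0 \<le> t \<and> t \<le> 1}"

definition arc_relint :: "arc \<Rightarrow> point set" where
  "arc_relint a = {sgn ((1 - t) *\<^sub>R fst a + t *\<^sub>R snd a) | t. 0 < t \<and> t < 1}"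

definition blocks :: "arc \<Rightarrow> arc \<Rightarrow> bool" where
  "blocks a b \<longleftrightarrow> (\<exists>e \<in> endpoints b. e \<in> arc_relint a)"

definition hits :: "arc \<Rightarrow> arc \<Rightarrow> bool" where
  "hits b a \<longleftrightarrow> blocks a b"

definition spherical_diagram :: "arc set \<Rightarrow> bool" where
  "spherical_diagram D \<longleftrightarrow>
     finite D \<and> D \<noteq> {} \<and> (\<forall>a \<in> D. is_arc a) \<and>
     (\<forall>a \<in> D. \<forall>b \<in> D. a \<noteq> b \<longrightarrow> arc_relint a \<inter> arc_relint b = {}) \<and>
     (\<forall>b \<in> D. \<forall>e \<in> endpoints b. \<exists>a \<in> D. e \<in> arc_relint a)"

text \<open>Orientation of three points of the sphere: positive = counterclockwise
  (seen from outside the sphere), negative = clockwise.\<close>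
definition orient :: "point \<Rightarrow> point \<Rightarrow> point \<Rightarrow> real" where
  "orient p q r = cross3 p q \<bullet> r"

text \<open>A swirl: a cyclic list a_0,...,a_(d-1) of distinct arcs of D, where a_i hits
  a_(i+1) at its endpoint e_i (indices mod d); travelling along a_i towards e_i
  and then along a_(i+1) towards e_(i+1), the turn at e_i has sign
  orient e_(i-1) e_i e_(i+1). Clockwise: all turns clockwise (negative).\<close>
definition swirl_with :: "(real \<Rightarrow> bool) \<Rightarrow> arc set \<Rightarrow> arc list \<Rightarrow> bool" where
  "swirl_with P D s \<longleftrightarrow>
     s \<noteq> [] \<and> set s \<subseteq> D \<and> distinct s \<and>
     (\<exists>e :: nat \<Rightarrow> point. \<forall>i < length s.
        e i \<in> endpoints (s ! i) \<and>
        e i \<in> arc_relint (s ! ((i + 1) mod length s)) \<and>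
        P (orient (e ((i + length s - 1) mod length s)) (e i) (e ((i + 1) mod length s))))"

definition clockwise_swirl :: "arc set \<Rightarrow> arc list \<Rightarrow> bool" where
  "clockwise_swirl D s \<longleftrightarrow> swirl_with (\<lambda>x. x < 0) D s"

definition counterclockwise_swirl :: "arc set \<Rightarrow> arc list \<Rightarrow> bool" where
  "counterclockwise_swirl D s \<longleftrightarrow> swirl_with (\<lambda>x. x > 0) D s"

definition same_cycle :: "'a list \<Rightarrow> 'a list \<Rightarrow> bool" where
  "same_cycle s t \<longleftrightarrow> (\<exists>k. t = rotate k s)"

end

theory Submission
  imports Defs
begin

text \<open>Always turning right, a walk along the arcs ends in a cycle. A closed walk \<open>\<tau>\<close> defines a potential
  on its complement, the signed number of crossings with \<open>\<tau>\<close> on the way from a base point; it goes up by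
  one when \<open>\<tau>\<close> is crossed from left to right. Since arcs do not cross, a point following a right-turning
  walk on its right side meets \<open>\<tau>\<close> only where \<open>\<tau>\<close> hits the current arc from the right, so the potential
  never decreases along the walk.

  A second cycle: let \<open>x\<close> lie immediately to the right of a cycle, and let \<open>\<tau>\<close> be a closed walk keeping
  \<open>x\<close> on its left. The potential of \<open>\<tau>\<close> at \<open>x\<close> is smaller than on the right side of \<open>\<tau>\<close>, so right-turning
  walks that start on \<open>\<tau>\<close> never enter the first cycle.

  A right-turning cycle does not use an arc in both directions: choose \<open>x\<close> where the potential of the
  cycle itself is maximal. From \<open>x\<close> only right sides of the cycle are visible. Following the visible part
  of the cycle, an obstruction would begin at a vertex where the cycle folds back, and the fold would show
  its left side; so all of the cycle is visible and has \<open>x\<close> on its right.\<close>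

unbundle no cross3_syntax

subsection \<open>Orientations and crossings\<close>

text \<open>Turning right is a map on directed arcs, whereas a swirl is a list of distinct arcs and
  two swirls are the same when their arc lists agree up to rotation. Two cycles of states are
  therefore not enough: each cycle must use every arc in one direction only, and the second must not
  run through the arcs of the first in reverse. No Jordan curve theorem enters. Points are vectors
  up to positive scaling, and a potential difference is a finite sum of sign conditions on
  determinants; its path independence is an identity for triangles. The price is general position:
  the relevant signs must be nonzero. Hence points beside a vertex e are taken in neighbourhoods of
  \<open>e + \<epsilon> *\<^sub>R z\<close> for small positive \<epsilon>: the direction z fixes the
  sector at e, and the neighbourhood leaves room to avoid finitely many planes. Counterclockwise
  swirls come from the antipodal diagram, as the point reflection reverses orientation in dimension
  three.\<close>

lemma orient_component:
  "orient p q r = p$1 * q$2 * r$3 - p$1 * q$3 * r$2 + p$2 * q$3 * r$1 - p$2 * q$1 * r$3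
     + p$3 * q$1 * r$2 - p$3 * q$2 * r$1"
  by (simp add: orient_def cross3_simps)

lemma orient_linear [simp]:
  "orient (p + p') q r = orient p q r + orient p' q r"
  "orient p (q + q') r = orient p q r + orient p q' r"
  "orient p q (r + r') = orient p q r + orient p q r'"
  "orient (p - p') q r = orient p q r - orient p' q r"
  "orient p (q - q') r = orient p q r - orient p q' r"
  "orient p q (r - r') = orient p q r - orient p q r'"
  "orient (k *\<^sub>R p) q r = k * orient p q r"
  "orient p (k *\<^sub>R q) r = k * orient p q r"
  "orient p q (k *\<^sub>R r) = k * orient p q r"
  "orient (- p) q r = - orient p q r"
  "orient p (- q) r = - orient p q r"
  "orient p q (- r) = - orient p q r"
  by (simp_all add: orient_component algebra_simps)

lemma orient_degenerate [simp]: "orient p p r = 0" "orient p q p = 0" "orient p q q = 0"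
  by (simp_all add: orient_component algebra_simps)

lemma orient_cycle: "orient q r p = orient p q r"
  by (simp add: orient_component algebra_simps)

lemma orient_cycle': "orient r p q = orient p q r"
  by (simp add: orient_component algebra_simps)

lemma orient_swap:
  "orient q p r = - orient p q r" "orient p r q = - orient p q r" "orient r q p = - orient p q r"
  by (simp_all add: orient_component algebra_simps)

lemma orient_cramer:
  "orient a b c *\<^sub>R w = orient w b c *\<^sub>R a + orient a w c *\<^sub>R b + orient a b w *\<^sub>R c"
  by (simp add: vec_eq_iff forall_3 orient_component algebra_simps)

text \<open>Both sides are the cross product of the normals \<open>cross3 p q\<close> and
  \<open>cross3 u v\<close>: a vector on the line where the planes pq and uv meet, written once in
  u, v and once in p, q.\<close>

lemma orient_meet:
  "orient p q v *\<^sub>R u - orient p q u *\<^sub>R v = orient u v p *\<^sub>R q - orient u v q *\<^sub>R p"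
  by (simp add: vec_eq_iff forall_3 orient_component algebra_simps)

text \<open>The three-term Grassmann-Pluecker relation: pair \<open>orient_meet\<close> with the
  normal of the plane qr.\<close>

lemma orient_relation:
  "orient p q v * orient q r u - orient p q u * orient q r v = - orient u v q * orient p q r"
  by (simp add: orient_component algebra_simps)

lemma continuous_on_orient [continuous_intros]:
  assumes "continuous_on S f" "continuous_on S g" "continuous_on S h"
  shows "continuous_on S (\<lambda>x. orient (f x) (g x) (h x))"
  unfolding orient_component by (intro continuous_intros assms)

lemma coplanar_imp_combination:
  assumes "orient p q r = 0" "cross3 q r \<noteq> 0"
  obtains \<alpha> \<beta> where "p = \<alpha> *\<^sub>R q + \<beta> *\<^sub>R r"
proof -
  let ?n = "cross3 q r"
  have nn: "orient q r ?n = ?n \<bullet> ?n" by (simp add: orient_def)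
  then have "?n \<bullet> ?n \<noteq> 0" using assms(2) by simp
  have "orient q r ?n *\<^sub>R p = orient p r ?n *\<^sub>R q + orient q p ?n *\<^sub>R r"
    using orient_cramer[of q r ?n p] assms(1) by (simp add: orient_cycle[of _ _ p])
  then have "p = (1 / (?n \<bullet> ?n)) *\<^sub>R (orient p r ?n *\<^sub>R q + orient q p ?n *\<^sub>R r)"
    using \<open>?n \<bullet> ?n \<noteq> 0\<close> nn by (metis divide_self_if scaleR_one scaleR_scaleR times_divide_eq_left mult_1)
  then have "p = (orient p r ?n / (?n \<bullet> ?n)) *\<^sub>R q + (orient q p ?n / (?n \<bullet> ?n)) *\<^sub>R r"
    by (simp add: scaleR_add_right)
  then show ?thesis using that by blast
qed

lemma cross3_nonzero_imp_independent:
  assumes "cross3 p q \<noteq> 0" "\<alpha> *\<^sub>R p + \<beta> *\<^sub>R q = 0"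
  shows "\<alpha> = 0" "\<beta> = 0"
proof -
  have "cross3 (\<alpha> *\<^sub>R p + \<beta> *\<^sub>R q) q = \<alpha> *\<^sub>R cross3 p q"
    by (simp add: cross3_simps)
  moreover have "cross3 p (\<alpha> *\<^sub>R p + \<beta> *\<^sub>R q) = \<beta> *\<^sub>R cross3 p q"
    by (simp add: cross3_simps)
  ultimately show "\<alpha> = 0" "\<beta> = 0" using assms by auto
qed

lemma cross3_eq_0_unit:
  assumes "cross3 p q = 0" "norm p = 1" "norm q = 1"
  shows "p = q \<or> p = - q"
proof -
  have "p \<bullet> q * (p \<bullet> q) = 1"
    using norm_cross_dot[of p q] assms by (simp add: power2_eq_square)
  then have "p \<bullet> q = 1 \<or> p \<bullet> q = -1"
    by (metis (no_types) square_eq_1_iff)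
  then have "norm (p - q) ^ 2 = 0 \<or> norm (p + q) ^ 2 = 0"
    using assms(2,3) unfolding power2_norm_eq_inner
    by (auto simp: inner_diff_left inner_diff_right inner_add_left inner_add_right inner_commute
        norm_eq_1)
  then show ?thesis by (auto simp: add_eq_0_iff)
qed

text \<open>Signed crossing number of the segment \<open>pq\<close> with the segment \<open>uv\<close> (as cones over the origin):
  \<open>1\<close> if \<open>pq\<close> passes from the left to the right of \<open>uv\<close>.\<close>

definition crossing :: "point \<Rightarrow> point \<Rightarrow> point \<Rightarrow> point \<Rightarrow> int" where
  "crossing p q u v =
     (if orient p q u < 0 \<and> orient p q v > 0 \<and> orient u v p > 0 \<and> orient u v q < 0 then 1
      else if orient p q u > 0 \<and> orient p q v < 0 \<and> orient u v p < 0 \<and> orient u v q > 0 then - 1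
      else 0)"

lemma crossing_commute: "crossing q p u v = - crossing p q u v"
  using orient_swap(1)[of q p u] orient_swap(1)[of q p v] by (auto simp: crossing_def)

lemma crossing_bounds: "\<bar>crossing p q u v\<bar> \<le> 1"
  by (simp add: crossing_def)

text \<open>The signed indicator of the open cone over a nondegenerate triangle pqr: nonzero exactly
  when w is a positive combination of p, q, r, and then the orientation of the triangle.\<close>

definition cone_sign :: "point \<Rightarrow> point \<Rightarrow> point \<Rightarrow> point \<Rightarrow> int" where
  "cone_sign p q r w =
     (if orient p q r > 0 \<and> orient p q w > 0 \<and> orient q r w > 0 \<and> orient r p w > 0 then 1
      else if orient p q r < 0 \<and> orient p q w < 0 \<and> orient q r w < 0 \<and> orient r p w < 0 then - 1
      else 0)"

text \<open>Each variable says that one determinant is positive. The six implications are what the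
  three Grassmann-Pluecker relations say about signs, the last two exclusions come from a linear
  dependency; the rest is a finite check.\<close>

lemma crossing_triangle_signs:
  "\<forall>D xu xv yu yv zu zv a b c.
    (xv = yu \<and> xu \<noteq> yv \<longrightarrow> b \<noteq> D) \<and> (xv \<noteq> yu \<and> xu = yv \<longrightarrow> b = D) \<and>
    (yv = zu \<and> yu \<noteq> zv \<longrightarrow> c \<noteq> D) \<and> (yv \<noteq> zu \<and> yu = zv \<longrightarrow> c = D) \<and>
    (zv = xu \<and> zu \<noteq> xv \<longrightarrow> a \<noteq> D) \<and> (zv \<noteq> xu \<and> zu = xv \<longrightarrow> a = D) \<and>
    \<not> (a = yu \<and> b = zu \<and> c = xu) \<and> \<not> (a \<noteq> yu \<and> b \<noteq> zu \<and> c \<noteq> xu) \<longrightarrow>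
   ((if \<not> xu \<and> xv \<and> a \<and> \<not> b then 1 else if xu \<and> \<not> xv \<and> \<not> a \<and> b then - 1 else 0) :: int)
     + (if \<not> yu \<and> yv \<and> b \<and> \<not> c then 1 else if yu \<and> \<not> yv \<and> \<not> b \<and> c then - 1 else 0)
     + (if \<not> zu \<and> zv \<and> c \<and> \<not> a then 1 else if zu \<and> \<not> zv \<and> \<not> c \<and> a then - 1 else 0)
     = (if D \<and> xv \<and> yv \<and> zv then 1 else if \<not> D \<and> \<not> xv \<and> \<not> yv \<and> \<not> zv then - 1 else 0)
     - (if D \<and> xu \<and> yu \<and> zu then 1 else if \<not> D \<and> \<not> xu \<and> \<not> yu \<and> \<not> zu then - 1 else 0)"
  unfolding all_bool_eq by (simp only: simp_thms if_True if_False; simp)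

text \<open>The segment uv changes its membership in the triangle where it crosses the boundary, and
  an entry counts opposite to an exit. Around a closed walk the right-hand side telescopes.\<close>

lemma crossing_triangle:
  assumes nz: "orient p q r \<noteq> 0" "orient p q u \<noteq> 0" "orient q r u \<noteq> 0" "orient r p u \<noteq> 0"
    "orient p q v \<noteq> 0" "orient q r v \<noteq> 0" "orient r p v \<noteq> 0"
    "orient u v p \<noteq> 0" "orient u v q \<noteq> 0" "orient u v r \<noteq> 0"
  shows "crossing p q u v + crossing q r u v + crossing r p u v = cone_sign p q r v - cone_sign p q r u"
proof -
  define xu yu zu xv yv zv a b c D where defs:
    "xu = orient p q u" "yu = orient q r u" "zu = orient r p u"
    "xv = orient p q v" "yv = orient q r v" "zv = orient r p v"
    "a = orient u v p" "b = orient u v q" "c = orient u v r" "D = orient p q r"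
  have R: "xv * yu - xu * yv = - b * D" "yv * zu - yu * zv = - c * D" "zv * xu - zu * xv = - a * D"
    using orient_relation[of p q v r u] orient_relation[of q r v p u] orient_relation[of r p v q u]
    unfolding defs by (simp_all add: orient_cycle orient_cycle')
  have rule: "(X * Y > 0 \<and> X' * Y' < 0 \<longrightarrow> B * D < 0) \<and> (X * Y < 0 \<and> X' * Y' > 0 \<longrightarrow> B * D > 0)"
    if "X * Y - X' * Y' = - B * D" for X Y X' Y' B :: real
    using that by (auto simp: algebra_simps)
  have pos: "x * y > 0 \<longleftrightarrow> (x > 0) = (y > 0)" and neg: "x * y < 0 \<longleftrightarrow> (x > 0) \<noteq> (y > 0)"
    if "x \<noteq> 0" "y \<noteq> 0" for x y :: real
    using that by (auto simp: zero_less_mult_iff mult_less_0_iff)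
  have rule': "((X > 0) = (Y > 0) \<and> (X' > 0) \<noteq> (Y' > 0) \<longrightarrow> (B > 0) \<noteq> (D > 0)) \<and>
      ((X > 0) \<noteq> (Y > 0) \<and> (X' > 0) = (Y' > 0) \<longrightarrow> (B > 0) = (D > 0))"
    if "X * Y - X' * Y' = - B * D" "X \<noteq> 0" "Y \<noteq> 0" "X' \<noteq> 0" "Y' \<noteq> 0" "B \<noteq> 0" for X Y X' Y' B :: real
    using rule[OF that(1)] that(2-) nz(1)[folded defs] by (simp add: pos neg)
  \<comment> \<open>The three relations alone leave spurious patterns, such as u inside the cone and
    v inside its negative with no crossing counted. Expanding the vanishing
    \<open>orient u v u\<close> in p, q, r excludes them.\<close>
  have "orient u v (orient u q r *\<^sub>R p + orient p u r *\<^sub>R q + orient p q u *\<^sub>R r) = 0"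
    unfolding orient_cramer[symmetric] by simp
  then have "a * yu + b * zu + c * xu = 0"
    unfolding defs by (simp add: orient_cycle orient_cycle' algebra_simps)
  then have "\<not> (a * yu > 0 \<and> b * zu > 0 \<and> c * xu > 0) \<and> \<not> (a * yu < 0 \<and> b * zu < 0 \<and> c * xu < 0)"
    by linarith
  then have last: "\<not> ((a > 0) = (yu > 0) \<and> (b > 0) = (zu > 0) \<and> (c > 0) = (xu > 0)) \<and>
      \<not> ((a > 0) \<noteq> (yu > 0) \<and> (b > 0) \<noteq> (zu > 0) \<and> (c > 0) \<noteq> (xu > 0))"
    using nz[folded defs] by (simp add: pos neg)
  note nz' = nz[folded defs]
  have negI: "X < 0 \<longleftrightarrow> \<not> X > 0" if "X \<noteq> 0" for X :: real
    using that by auto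
  show ?thesis
    unfolding crossing_def cone_sign_def defs[symmetric] nz'[THEN negI]
    by (rule crossing_triangle_signs[rule_format])
      (use rule'[OF R(1)] rule'[OF R(2)] rule'[OF R(3)] last nz' in blast)
qed

text \<open>At a crossing the vector of \<open>orient_meet\<close> is, up to a common sign, a
  positive combination of u, v and of p, q, so h would have both signs on it.\<close>

lemma crossing_eq_0_if_separated:
  assumes "h \<bullet> p > 0" "h \<bullet> q > 0" "h \<bullet> u < 0" "h \<bullet> v < 0"
  shows "crossing p q u v = 0"
proof -
  have eq: "orient p q v * (h \<bullet> u) - orient p q u * (h \<bullet> v) = orient u v p * (h \<bullet> q) - orient u v q * (h \<bullet> p)"
    using arg_cong[OF orient_meet[of p q v u], of "\<lambda>x. h \<bullet> x"] by (simp add: inner_diff_right)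
  show ?thesis
  proof (rule ccontr)
    assume "crossing p q u v \<noteq> 0"
    then consider "orient p q u < 0" "orient p q v > 0" "orient u v p > 0" "orient u v q < 0"
      | "orient p q u > 0" "orient p q v < 0" "orient u v p < 0" "orient u v q > 0"
      by (auto simp: crossing_def split: if_splits)
    then show False
    proof cases
      case 1
      then have "orient p q v * (h \<bullet> u) < 0" "orient p q u * (h \<bullet> v) > 0"
        "orient u v p * (h \<bullet> q) > 0" "orient u v q * (h \<bullet> p) < 0"
        using assms by (auto intro: mult_pos_neg mult_neg_neg mult_pos_pos mult_neg_pos)
      with eq show False by linarith
    next
      case 2
      then have "orient p q v * (h \<bullet> u) > 0" "orient p q u * (h \<bullet> v) < 0"
        "orient u v p * (h \<bullet> q) < 0" "orient u v q * (h \<bullet> p) > 0"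
        using assms by (auto intro: mult_pos_neg mult_neg_neg mult_pos_pos mult_neg_pos)
      with eq show False by linarith
    qed
  qed
qed

text \<open>The hypothesis keeps 0 out of the convex hull of p, q, -u, -v; a hyperplane separating
  this hull from 0 has the required signs.\<close>

lemma cones_separated:
  fixes p q u v :: point
  assumes "\<And>\<alpha> \<beta> \<gamma> \<delta>. \<lbrakk>\<alpha> \<ge> 0; \<beta> \<ge> 0; \<gamma> \<ge> 0; \<delta> \<ge> 0; \<alpha> *\<^sub>R p + \<beta> *\<^sub>R q = \<gamma> *\<^sub>R u + \<delta> *\<^sub>R v\<rbrakk>
      \<Longrightarrow> \<alpha> = 0 \<and> \<beta> = 0 \<and> \<gamma> = 0 \<and> \<delta> = 0"
  obtains h where "h \<bullet> p > 0" "h \<bullet> q > 0" "h \<bullet> u < 0" "h \<bullet> v < 0"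
proof -
  let ?S = "convex hull {p, q, - u, - v}"
  have "0 \<notin> ?S"
  proof
    assume "0 \<in> ?S"
    then obtain a1 b1 a2 b2 a3 b3 where c: "a1 \<ge> 0" "b1 \<ge> 0" "a1 + b1 = 1" "a2 \<ge> 0" "b2 \<ge> 0" "a2 + b2 = 1"
        "a3 \<ge> 0" "b3 \<ge> 0" "a3 + b3 = 1"
      and z: "0 = a1 *\<^sub>R p + b1 *\<^sub>R (a2 *\<^sub>R q + b2 *\<^sub>R (a3 *\<^sub>R (- u) + b3 *\<^sub>R (- v)))"
      unfolding convex_hull_insert[of "{q, - u, - v}" p, simplified]
        convex_hull_insert[of "{- u, - v}" q, simplified] convex_hull_2
      by auto
    have "a1 *\<^sub>R p + (b1 * a2) *\<^sub>R q = (b1 * b2 * a3) *\<^sub>R u + (b1 * b2 * b3) *\<^sub>R v"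
      using z by (simp add: algebra_simps)
    then have "a1 = 0 \<and> b1 * a2 = 0 \<and> b1 * b2 * a3 = 0 \<and> b1 * b2 * b3 = 0"
      using c by (intro assms) auto
    then show False using c by auto
  qed
  moreover have "closed ?S" "convex ?S"
    by (simp_all add: compact_imp_closed finite_imp_compact_convex_hull)
  ultimately obtain h b where "0 < b" "\<forall>x\<in>?S. inner h x > b"
    using separating_hyperplane_closed_0[of ?S] by blast
  then have "h \<bullet> x > 0" if "x \<in> {p, q, - u, - v}" for x
    using that hull_subset[of "{p, q, - u, - v}" convex] by fastforce
  from this[of p] this[of q] this[of "- u"] this[of "- v"] show ?thesis
    using that by simp
qed

section \<open>Perturbation and general position\<close>

lemma eventually_nhds_pos:
  assumes "f p > (0::real)" "continuous_on UNIV f"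
  shows "\<forall>\<^sub>F x in nhds p. f x > 0"
  using assms order_tendstoD(1)[of f "f p" "nhds p" 0]
  by (simp add: continuous_on_def tendsto_at_iff_tendsto_nhds)

lemma eventually_nhds_neg:
  assumes "f p < (0::real)" "continuous_on UNIV f"
  shows "\<forall>\<^sub>F x in nhds p. f x < 0"
  using eventually_nhds_pos[of "\<lambda>x. - f x" p] assms by (simp add: continuous_on_minus)

text \<open>Strict separation survives perturbation. The neighbourhoods are nested because the
  second point is later chosen after the first has been fixed.\<close>

lemma crossing_eventually_0:
  assumes "\<And>\<alpha> \<beta> \<gamma> \<delta>. \<lbrakk>\<alpha> \<ge> 0; \<beta> \<ge> 0; \<gamma> \<ge> 0; \<delta> \<ge> 0; \<alpha> *\<^sub>R p + \<beta> *\<^sub>R q = \<gamma> *\<^sub>R u + \<delta> *\<^sub>R v\<rbrakk>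
      \<Longrightarrow> \<alpha> = 0 \<and> \<beta> = 0 \<and> \<gamma> = 0 \<and> \<delta> = 0"
  shows "\<forall>\<^sub>F r in nhds p. \<forall>\<^sub>F s in nhds q. crossing r s u v = 0"
proof -
  obtain h where h: "h \<bullet> p > 0" "h \<bullet> q > 0" "h \<bullet> u < 0" "h \<bullet> v < 0"
    using cones_separated[OF assms] by blast
  have "\<forall>\<^sub>F r in nhds p. h \<bullet> r > 0"
    by (rule eventually_nhds_pos) (use h in \<open>auto intro: continuous_intros\<close>)
  then show ?thesis
  proof eventually_elim
    case (elim r)
    have "\<forall>\<^sub>F s in nhds q. h \<bullet> s > 0"
      by (rule eventually_nhds_pos) (use h in \<open>auto intro: continuous_intros\<close>)
    then show ?case
      by eventually_elim (use elim h crossing_eq_0_if_separated in blast)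
  qed
qed

text \<open>Finitely many planes through the origin form a null set and cannot cover a
  neighbourhood.\<close>

lemma generic_point:
  fixes q :: point
  assumes "\<forall>\<^sub>F p in nhds q. P p" "finite X" "\<And>a b. (a, b) \<in> X \<Longrightarrow> cross3 a b \<noteq> 0"
  obtains p where "P p" "\<And>a b. (a, b) \<in> X \<Longrightarrow> orient a b p \<noteq> 0"
proof -
  obtain O' where O': "open O'" "q \<in> O'" "\<And>p. p \<in> O' \<Longrightarrow> P p"
    using assms(1) by (auto simp: eventually_nhds)
  have "negligible (\<Union>(a, b)\<in>X. {p. cross3 a b \<bullet> p = 0})"
    using assms(2,3) by (intro negligible_Union) (auto intro!: negligible_hyperplane)
  then have "\<not> O' \<subseteq> (\<Union>(a, b)\<in>X. {p. cross3 a b \<bullet> p = 0})"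
    using open_not_negligible[OF O'(1)] O'(2) negligible_subset by blast
  then show ?thesis
    using that O'(3) by (force simp: orient_def)
qed

subsection \<open>Arcs as cones\<close>

text \<open>Cones over the relative interiors avoid the normalisation \<open>sgn\<close> in \<^const>\<open>arc_relint\<close>.\<close>

definition arc_cone :: "arc \<Rightarrow> point set" where
  "arc_cone a = {\<alpha> *\<^sub>R fst a + \<beta> *\<^sub>R snd a | \<alpha> \<beta>. \<alpha> > 0 \<and> \<beta> > 0}"

definition other_end :: "arc \<Rightarrow> point \<Rightarrow> point" where
  "other_end a e = (if e = fst a then snd a else fst a)"

lemma arc_cross3_nonzero: "is_arc a \<Longrightarrow> cross3 (fst a) (snd a) \<noteq> 0"
  using cross3_eq_0_unit[of "fst a" "snd a"] by (auto simp: is_arc_def on_sphere_def)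

lemma arc_relint_subset_cone:
  assumes "is_arc a"
  shows "arc_relint a \<subseteq> arc_cone a"
proof
  fix p assume "p \<in> arc_relint a"
  then obtain t where t: "0 < t" "t < 1" "p = sgn ((1 - t) *\<^sub>R fst a + t *\<^sub>R snd a)"
    by (auto simp: arc_relint_def)
  let ?x = "(1 - t) *\<^sub>R fst a + t *\<^sub>R snd a"
  have "?x \<noteq> 0"
    using cross3_nonzero_imp_independent(2)[OF arc_cross3_nonzero[OF assms]] t by blast
  then have "inverse (norm ?x) > 0" by simp
  moreover have "p = (inverse (norm ?x) * (1 - t)) *\<^sub>R fst a + (inverse (norm ?x) * t) *\<^sub>R snd a"
    unfolding t(3) sgn_div_norm by (simp add: scaleR_add_right)
  ultimately show "p \<in> arc_cone a"
    using t unfolding arc_cone_def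
    by (smt (verit) mem_Collect_eq mult_pos_pos)
qed

lemma sgn_arc_cone:
  assumes "p \<in> arc_cone a"
  shows "sgn p \<in> arc_relint a"
proof -
  obtain \<alpha> \<beta> where c: "\<alpha> > 0" "\<beta> > 0" "p = \<alpha> *\<^sub>R fst a + \<beta> *\<^sub>R snd a"
    using assms by (auto simp: arc_cone_def)
  have "1 - \<beta> / (\<alpha> + \<beta>) = \<alpha> / (\<alpha> + \<beta>)" using c by (simp add: field_simps)
  then have "p = (\<alpha> + \<beta>) *\<^sub>R ((1 - \<beta> / (\<alpha> + \<beta>)) *\<^sub>R fst a + (\<beta> / (\<alpha> + \<beta>)) *\<^sub>R snd a)"
    using c by (simp add: scaleR_add_right)
  then have "sgn p = sgn ((1 - \<beta> / (\<alpha> + \<beta>)) *\<^sub>R fst a + (\<beta> / (\<alpha> + \<beta>)) *\<^sub>R snd a)"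
    using c by (metis add_pos_pos scaleR_one sgn_scaleR sgn_pos)
  moreover have "0 < \<beta> / (\<alpha> + \<beta>)" "\<beta> / (\<alpha> + \<beta>) < 1" using c by auto
  ultimately show ?thesis unfolding arc_relint_def by blast
qed

lemma other_end_endpoint [simp]: "other_end a e \<in> endpoints a"
  by (auto simp: other_end_def endpoints_def)

lemma cross3_other_end:
  assumes "is_arc a" "e \<in> endpoints a"
  shows "cross3 (other_end a e) e \<noteq> 0"
  using arc_cross3_nonzero[OF assms(1)] assms(2) cross_skew[of "fst a" "snd a"]
  by (auto simp: other_end_def endpoints_def)

lemma arc_cone_other_end:
  assumes "e \<in> endpoints a"
  shows "arc_cone a = {\<alpha> *\<^sub>R other_end a e + \<beta> *\<^sub>R e | \<alpha> \<beta>. \<alpha> > 0 \<and> \<beta> > 0}"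
  using assms by (auto simp: arc_cone_def other_end_def endpoints_def) (metis add.commute)+

lemma arc_cone_combination:
  assumes "p \<in> arc_cone a" "e \<in> endpoints a" "\<gamma> > 0" "\<delta> \<ge> 0"
  shows "\<gamma> *\<^sub>R p + \<delta> *\<^sub>R e \<in> arc_cone a"
proof -
  obtain \<alpha> \<beta> where c: "\<alpha> > 0" "\<beta> > 0" "p = \<alpha> *\<^sub>R other_end a e + \<beta> *\<^sub>R e"
    using assms arc_cone_other_end by blast
  have "\<gamma> *\<^sub>R p + \<delta> *\<^sub>R e = (\<gamma> * \<alpha>) *\<^sub>R other_end a e + (\<gamma> * \<beta> + \<delta>) *\<^sub>R e"
    by (simp add: c(3) algebra_simps)
  moreover have "\<gamma> * \<alpha> > 0" "\<gamma> * \<beta> + \<delta> > 0" using c assms by (auto intro: add_pos_nonneg)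
  ultimately show ?thesis using arc_cone_other_end[OF assms(2)] by blast
qed

lemma endpoint_notin_arc_cone:
  assumes "is_arc a" "e \<in> endpoints a"
  shows "e \<notin> arc_cone a" "\<gamma> *\<^sub>R e \<notin> arc_cone a"
proof -
  show *: "\<gamma> *\<^sub>R e \<notin> arc_cone a" for \<gamma>
  proof
    assume "\<gamma> *\<^sub>R e \<in> arc_cone a"
    then obtain \<alpha> \<beta> where c: "\<alpha> > 0" "\<gamma> *\<^sub>R e = \<alpha> *\<^sub>R other_end a e + \<beta> *\<^sub>R e"
      using arc_cone_other_end[OF assms(2)] by blast
    then have "\<alpha> *\<^sub>R other_end a e + (\<beta> - \<gamma>) *\<^sub>R e = 0"
      by (simp add: algebra_simps)
    then show False using cross3_nonzero_imp_independent(1)[OF cross3_other_end[OF assms]] c by auto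
  qed
  from *[of 1] show "e \<notin> arc_cone a" by simp
qed

lemma orient_arc_cone_other_end:
  assumes "w \<in> arc_cone a" "e \<in> endpoints a"
  obtains k where "k > 0" "\<And>X. orient w e X = k * orient (other_end a e) e X"
    "\<And>X. orient e w X = k * orient e (other_end a e) X"
  using assms arc_cone_other_end[OF assms(2)] by (auto intro!: that)

lemma other_end_other_end:
  assumes "is_arc a" "t \<in> endpoints a" "e \<in> endpoints a" "t \<noteq> e"
  shows "t = other_end a e" "e = other_end a t"
  using assms by (auto simp: other_end_def endpoints_def)

text \<open>Sides of an arc depend only on the direction of travel, so pieces starting at different
  points of the arc are interchangeable.\<close>

lemma orient_same_direction:
  assumes "w \<in> arc_cone a" "w' \<in> arc_cone a" "e \<in> endpoints a"
  obtains k where "k > 0" "\<And>X. orient w e X = k * orient w' e X"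
proof -
  obtain k where k: "k > 0" "\<And>X. orient w e X = k * orient (other_end a e) e X"
    using orient_arc_cone_other_end assms by metis
  obtain k' where k': "k' > 0" "\<And>X. orient w' e X = k' * orient (other_end a e) e X"
    using orient_arc_cone_other_end assms by metis
  show ?thesis using that[of "k / k'"] k k' by simp
qed

lemma orient_same_arc:
  assumes "is_arc a" "w \<in> arc_cone a" "w' \<in> arc_cone a" "e \<in> endpoints a" "e' \<in> endpoints a"
  obtains k where "k \<noteq> 0" "\<And>X. orient w e X = k * orient w' e' X"
proof (cases "e = e'")
  case True
  then show ?thesis using orient_same_direction[OF assms(2,3,4)] that by (metis less_irrefl)
next
  case False
  obtain k where k: "k > 0" "\<And>X. orient w e X = k * orient (other_end a e) e X"
    using orient_arc_cone_other_end assms by metis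
  obtain k' where k': "k' > 0" "\<And>X. orient w' e' X = k' * orient (other_end a e') e' X"
    using orient_arc_cone_other_end assms by metis
  have "orient (other_end a e) e X = - orient (other_end a e') e' X" for X
    using other_end_other_end[OF assms(1,4,5) False] orient_swap(1) by metis
  then show ?thesis using that[of "- k / k'"] k k' by simp
qed

lemma eventually_at_right_pos:
  assumes "f 0 > (0::real)" "continuous_on UNIV f"
  shows "\<forall>\<^sub>F \<epsilon> in at_right (0::real). f \<epsilon> > 0"
  using eventually_nhds_pos[OF assms] by (auto simp: eventually_at_filter elim: eventually_mono)

text \<open>The nested filter in the conclusion expresses "just beside e in direction z, with room
  for perturbation".\<close>

lemma eventually_nhds_along_ray:
  fixes e z :: point
  assumes "\<forall>\<^sub>F r in nhds e. Q r"
  shows "\<forall>\<^sub>F \<epsilon> in at_right 0. \<forall>\<^sub>F r in nhds (e + \<epsilon> *\<^sub>R z). Q r"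
proof -
  have "((\<lambda>\<epsilon>. e + \<epsilon> *\<^sub>R z) \<longlongrightarrow> e + 0 *\<^sub>R z) (at_right 0)"
    by (intro tendsto_intros)
  then have "filterlim (\<lambda>\<epsilon>. e + \<epsilon> *\<^sub>R z) (nhds e) (at_right 0)" by simp
  moreover have "\<forall>\<^sub>F x in nhds e. \<forall>\<^sub>F r in nhds x. Q r"
    using assms by (simp add: eventually_eventually)
  ultimately show ?thesis
    by (rule eventually_compose_filterlim[rotated])
qed

lemma crossing_nonneg:
  assumes "orient p q u \<le> 0 \<or> orient p q v \<ge> 0 \<or> orient u v p \<ge> 0 \<or> orient u v q \<le> 0"
  shows "crossing p q u v \<ge> 0"
  using assms by (auto simp: crossing_def)

lemma crossing_nonneg_same_side:
  assumes "orient u v p * orient u v q > 0"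
  shows "crossing p q u v \<ge> 0"
  using assms by (intro crossing_nonneg) (auto simp: zero_less_mult_iff)

lemma orient_arc:
  assumes "u \<in> arc_cone b" "t \<in> endpoints b"
  obtains k where "k \<noteq> 0" "\<And>X. orient u t X = k * orient (fst b) (snd b) X"
proof -
  obtain k where k: "k > 0" "\<And>X. orient u t X = k * orient (other_end b t) t X"
    using orient_arc_cone_other_end assms by metis
  show ?thesis
  proof (cases "t = fst b")
    case True
    then show ?thesis
      using k that[of "- k"] orient_swap(1)[of "snd b" "fst b"] by (simp add: other_end_def)
  next
    case False
    then have "t = snd b" using assms(2) by (simp add: endpoints_def)
    then show ?thesis using k that[of k] False by (simp add: other_end_def)
  qed
qed

lemma orient_arc_cone_0: "e \<in> arc_cone c \<Longrightarrow> orient (fst c) (snd c) e = 0"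
  by (auto simp: arc_cone_def)

lemma cross3_nonzero_piece:
  assumes "is_arc b" "u \<in> arc_cone b" "t \<in> endpoints b"
  shows "cross3 u t \<noteq> 0"
proof -
  obtain k where k: "k \<noteq> 0" "\<And>X. orient u t X = k * orient (fst b) (snd b) X"
    using orient_arc assms by metis
  have "orient (fst b) (snd b) (cross3 (fst b) (snd b)) \<noteq> 0"
    using arc_cross3_nonzero[OF assms(1)] by (simp add: orient_def)
  then have "orient u t (cross3 (fst b) (snd b)) \<noteq> 0" using k by simp
  then show ?thesis by (auto simp: orient_def)
qed

subsection \<open>Closed walks and their potential\<close>

locale diagram =
  fixes D :: "arc set"
  assumes diagram: "spherical_diagram D"
begin

lemma finite_D: "finite D" and D_nonempty: "D \<noteq> {}" and is_arc_D: "a \<in> D \<Longrightarrow> is_arc a"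
  using diagram by (auto simp: spherical_diagram_def)

lemma arc_cones_disjoint:
  assumes "a \<in> D" "b \<in> D" "p \<in> arc_cone a" "p \<in> arc_cone b"
  shows "a = b"
  using assms diagram sgn_arc_cone[OF assms(3)] sgn_arc_cone[OF assms(4)]
  unfolding spherical_diagram_def by blast

lemma endpoint_blocked:
  assumes "b \<in> D" "e \<in> endpoints b"
  obtains c where "c \<in> D" "e \<in> arc_cone c"
proof -
  obtain c where "c \<in> D" "e \<in> arc_relint c"
    using assms diagram unfolding spherical_diagram_def by blast
  then show ?thesis using that arc_relint_subset_cone[OF is_arc_D] by blast
qed

lemma endpoint_norm: "a \<in> D \<Longrightarrow> e \<in> endpoints a \<Longrightarrow> norm e = 1"
  using is_arc_D[of a] by (auto simp: is_arc_def on_sphere_def endpoints_def)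

text \<open>Otherwise a short step from e towards the other end of a would stay inside c, so that
  the interiors meet and a = c; but e ends a and is interior to c.\<close>

lemma blocker_transversal:
  assumes "a \<in> D" "e \<in> endpoints a" "c \<in> D" "e \<in> arc_cone c"
  shows "orient (fst c) (snd c) (other_end a e) \<noteq> 0"
proof
  let ?o = "other_end a e"
  assume "orient (fst c) (snd c) ?o = 0"
  then have "orient ?o (fst c) (snd c) = 0" by (simp add: orient_cycle)
  then obtain l m where o: "?o = l *\<^sub>R fst c + m *\<^sub>R snd c"
    using coplanar_imp_combination arc_cross3_nonzero is_arc_D[OF assms(3)] by metis
  obtain \<alpha> \<beta> where ab: "\<alpha> > 0" "\<beta> > 0" "e = \<alpha> *\<^sub>R fst c + \<beta> *\<^sub>R snd c"
    using assms(4) by (auto simp: arc_cone_def)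
  have "\<forall>\<^sub>F s in at_right (0::real). \<alpha> + s * l > 0" "\<forall>\<^sub>F s in at_right (0::real). \<beta> + s * m > 0"
    using ab by (auto intro!: eventually_at_right_pos continuous_intros)
  then have "\<forall>\<^sub>F s in at_right (0::real). s > 0 \<and> \<alpha> + s * l > 0 \<and> \<beta> + s * m > 0"
    using eventually_at_right_less[of "0::real"] by eventually_elim auto
  then obtain s where s: "s > 0" "\<alpha> + s * l > 0" "\<beta> + s * m > 0"
    using eventually_happens trivial_limit_at_right_real by blast
  have "e + s *\<^sub>R ?o = (\<alpha> + s * l) *\<^sub>R fst c + (\<beta> + s * m) *\<^sub>R snd c"
    unfolding o by (subst ab(3)) (simp add: algebra_simps)
  then have "e + s *\<^sub>R ?o \<in> arc_cone c" using s by (auto simp: arc_cone_def)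
  moreover have "e + s *\<^sub>R ?o = s *\<^sub>R ?o + 1 *\<^sub>R e" by simp
  then have "e + s *\<^sub>R ?o \<in> arc_cone a"
    using s(1) unfolding arc_cone_other_end[OF assms(2)] by (metis (mono_tags, lifting) mem_Collect_eq zero_less_one)
  ultimately have "a = c" using arc_cones_disjoint assms(1,3) by blast
  then show False using endpoint_notin_arc_cone(1)[OF is_arc_D[OF assms(1)] assms(2)] assms(4) by simp
qed

lemma turn_nonzero:
  assumes "a \<in> D" "w \<in> arc_cone a" "e \<in> endpoints a" "c \<in> D" "e \<in> arc_cone c" "t \<in> endpoints c"
  shows "orient w e t \<noteq> 0"
proof -
  obtain k where k: "k > 0" "\<And>X. orient w e X = k * orient (other_end a e) e X"
    using orient_arc_cone_other_end assms by metis
  obtain k' where k': "k' \<noteq> 0" "\<And>X. orient e t X = k' * orient (fst c) (snd c) X"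
    using orient_arc assms by metis
  have "orient (other_end a e) e t = k' * orient (fst c) (snd c) (other_end a e)"
    using k'(2) orient_cycle by metis
  then show ?thesis
    using k k' blocker_transversal[OF assms(1,3,4,5)] by simp
qed

text \<open>A directed arc: the point is the end towards which the arc is traversed.\<close>

definition states :: "(arc \<times> point) set" where
  "states = {(a, e). a \<in> D \<and> e \<in> endpoints a}"

lemma finite_states: "finite states"
proof -
  have "states \<subseteq> D \<times> (\<Union>a\<in>D. endpoints a)" by (auto simp: states_def)
  then show ?thesis
    by (rule finite_subset) (simp add: finite_D endpoints_def)
qed

text \<open>The direction taken on the next arc is free, so right-turning walks and walks circling a
  given point are both instances.\<close>

definition walk :: "(nat \<Rightarrow> arc \<times> point) \<Rightarrow> bool" where
  "walk \<tau> \<longleftrightarrow> (\<forall>i. \<tau> i \<in> states \<and> snd (\<tau> i) \<in> arc_cone (fst (\<tau> (Suc i))))"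

definition closed_walk :: "(nat \<Rightarrow> arc \<times> point) \<Rightarrow> nat \<Rightarrow> bool" where
  "closed_walk \<tau> n \<longleftrightarrow> walk \<tau> \<and> n > 0 \<and> (\<forall>i. \<tau> (i + n) = \<tau> i)"

text \<open>The k-th piece is the traversed part of the arc of state \<open>Suc k\<close>; the part
  before the hit point is left out, so that the pieces of a closed walk form a closed
  polygon.\<close>

definition net_crossing :: "(nat \<Rightarrow> arc \<times> point) \<Rightarrow> nat \<Rightarrow> point \<Rightarrow> point \<Rightarrow> int" where
  "net_crossing \<tau> n p q = (\<Sum>k<n. crossing p q (snd (\<tau> k)) (snd (\<tau> (Suc k))))"

lemma net_crossing_commute: "net_crossing \<tau> n q p = - net_crossing \<tau> n p q"
  unfolding net_crossing_def by (simp add: crossing_commute[of q p] sum_negf)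

lemma net_crossing_triangle:
  assumes "closed_walk \<tau> n" "orient p q r \<noteq> 0"
    and v: "\<And>k. orient p q (snd (\<tau> k)) \<noteq> 0" "\<And>k. orient q r (snd (\<tau> k)) \<noteq> 0" "\<And>k. orient r p (snd (\<tau> k)) \<noteq> 0"
    and "\<And>k. orient (snd (\<tau> k)) (snd (\<tau> (Suc k))) p \<noteq> 0" "\<And>k. orient (snd (\<tau> k)) (snd (\<tau> (Suc k))) q \<noteq> 0"
      "\<And>k. orient (snd (\<tau> k)) (snd (\<tau> (Suc k))) r \<noteq> 0"
  shows "net_crossing \<tau> n p q + net_crossing \<tau> n q r + net_crossing \<tau> n r p = 0"
proof -
  have "net_crossing \<tau> n p q + net_crossing \<tau> n q r + net_crossing \<tau> n r p
      = (\<Sum>k<n. cone_sign p q r (snd (\<tau> (Suc k))) - cone_sign p q r (snd (\<tau> k)))"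
    unfolding net_crossing_def sum.distrib[symmetric]
    by (intro sum.cong refl crossing_triangle assms)
  also have "\<dots> = cone_sign p q r (snd (\<tau> n)) - cone_sign p q r (snd (\<tau> 0))"
    by (rule sum_lessThan_telescope)
  also have "\<tau> n = \<tau> 0" using assms(1) by (metis closed_walk_def add_0)
  finally show ?thesis by simp
qed

lemma walkD:
  assumes "walk \<tau>"
  shows "fst (\<tau> i) \<in> D" "snd (\<tau> i) \<in> endpoints (fst (\<tau> i))" "snd (\<tau> i) \<in> arc_cone (fst (\<tau> (Suc i)))"
    "is_arc (fst (\<tau> i))" "norm (snd (\<tau> i)) = 1"
proof -
  have "\<tau> i \<in> states" using assms by (simp add: walk_def)
  then show *: "fst (\<tau> i) \<in> D" "snd (\<tau> i) \<in> endpoints (fst (\<tau> i))"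
    by (simp_all add: states_def case_prod_beta)
  show "is_arc (fst (\<tau> i))" "norm (snd (\<tau> i)) = 1"
    using is_arc_D[OF *(1)] endpoint_norm[OF *] by simp_all
  show "snd (\<tau> i) \<in> arc_cone (fst (\<tau> (Suc i)))" using assms by (simp add: walk_def)
qed

lemma walk_piece_nonzero: "walk \<tau> \<Longrightarrow> cross3 (snd (\<tau> i)) (snd (\<tau> (Suc i))) \<noteq> 0"
  using cross3_nonzero_piece walkD by metis

text \<open>A point moving close along the right side of an arc only meets pieces of walks that end on
  that arc, and crosses them from left to right.\<close>

lemma crossing_nonneg_along_arc:
  assumes a: "a \<in> D" "w \<in> arc_cone a" "e \<in> endpoints a"
    and c: "c \<in> D" "e \<in> arc_cone c"
    and b: "b \<in> D" "u \<in> arc_cone b" "t \<in> endpoints b"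
    and z: "orient w e z < 0" "orient (fst c) (snd c) w * orient (fst c) (snd c) z > 0"
  shows "\<forall>\<^sub>F R in nhds w. orient w e R < 0 \<longrightarrow>
      (\<forall>\<^sub>F \<epsilon> in at_right 0. \<forall>\<^sub>F R' in nhds (e + \<epsilon> *\<^sub>R z). crossing R R' u t \<ge> 0)"
proof -
  note [simp] = is_arc_D[OF a(1)] is_arc_D[OF b(1)] is_arc_D[OF c(1)]
  have pos: "\<forall>\<^sub>F \<epsilon> in at_right (0::real). \<epsilon> > 0" by (rule eventually_at_right_less)
  \<comment> \<open>The direction z points to the right of a and to the side of c where w lies. A
    piece on a or on c has R and R' on the same side; a piece ending on the segment from w to e has
    its end to the left of RR'; any other piece is separated from the segment by a plane.\<close>
  consider (ends) \<alpha> \<beta> where "\<alpha> \<ge> 0" "\<beta> \<ge> 0" "t = \<alpha> *\<^sub>R w + \<beta> *\<^sub>R e"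
    | (same) "b = a" | (blocker) "b = c"
    | (apart) "b \<noteq> a" "b \<noteq> c" "\<And>\<alpha> \<beta>. \<alpha> \<ge> 0 \<Longrightarrow> \<beta> \<ge> 0 \<Longrightarrow> t \<noteq> \<alpha> *\<^sub>R w + \<beta> *\<^sub>R e"
    by blast
  then show ?thesis
  proof cases
    case ends
    have "orient w z e > 0" using z(1) orient_swap(2)[of w z e] by simp
    then have "\<forall>\<^sub>F R in nhds w. orient R z e > 0"
      by (intro eventually_nhds_pos continuous_intros)
    then show ?thesis
    proof eventually_elim
      case (elim R)
      show ?case
      proof
        assume R: "orient w e R < 0"
        have "orient R e w > 0" using R orient_swap(3)[of w e R] by simp
        then have "\<forall>\<^sub>F \<epsilon> in at_right (0::real). orient R (e + \<epsilon> *\<^sub>R z) w > 0"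
          by (intro eventually_at_right_pos continuous_intros) simp
        with pos show "\<forall>\<^sub>F \<epsilon> in at_right 0. \<forall>\<^sub>F R' in nhds (e + \<epsilon> *\<^sub>R z). crossing R R' u t \<ge> 0"
        proof eventually_elim
          case (elim \<epsilon>)
          have "\<forall>\<^sub>F R' in nhds (e + \<epsilon> *\<^sub>R z). orient R R' w > 0"
            using elim by (intro eventually_nhds_pos continuous_intros)
          moreover have "\<forall>\<^sub>F R' in nhds (e + \<epsilon> *\<^sub>R z). orient R R' e > 0"
            using elim \<open>orient R z e > 0\<close> by (intro eventually_nhds_pos continuous_intros) simp
          ultimately show ?case
            by eventually_elim (use ends in \<open>auto intro!: crossing_nonneg\<close>)
        qed
      qed
    qed
  next
    case same
    then obtain k where k: "k \<noteq> 0" "\<And>X. orient u t X = k * orient w e X"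
      using orient_same_arc[of a u w t e] a b by auto
    show ?thesis
    proof (rule always_eventually, intro allI impI)
      fix R assume R: "orient w e R < 0"
      show "\<forall>\<^sub>F \<epsilon> in at_right 0. \<forall>\<^sub>F R' in nhds (e + \<epsilon> *\<^sub>R z). crossing R R' u t \<ge> 0"
        using pos
      proof eventually_elim
        case (elim \<epsilon>)
        then have "\<forall>\<^sub>F R' in nhds (e + \<epsilon> *\<^sub>R z). orient w e R' < 0"
          using z(1) by (intro eventually_nhds_neg continuous_intros) (simp add: mult_pos_neg)
        then show ?case
        proof eventually_elim
          case (elim R')
          then have "0 < (k * k) * (orient w e R * orient w e R')"
            using R mult_neg_neg[OF R elim] k(1) not_real_square_gt_zero[of k] mult_pos_pos by blast
          also have "\<dots> = orient u t R * orient u t R'" by (simp add: k(2))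
          finally show ?case by (rule crossing_nonneg_same_side)
        qed
      qed
    qed
  next
    case blocker
    let ?P = "orient (fst c) (snd c)"
    obtain k where k: "k \<noteq> 0" "\<And>X. orient u t X = k * ?P X"
      using orient_arc b blocker by metis
    have nz: "?P w * ?P w > 0" using z(2) by (auto simp: zero_less_mult_iff)
    then have "\<forall>\<^sub>F R in nhds w. ?P w * ?P R > 0"
      by (intro eventually_nhds_pos continuous_intros)
    then show ?thesis
    proof eventually_elim
      case (elim R)
      note R = elim
      have "\<forall>\<^sub>F \<epsilon> in at_right 0. \<forall>\<^sub>F R' in nhds (e + \<epsilon> *\<^sub>R z). crossing R R' u t \<ge> 0"
        using pos
      proof eventually_elim
        case (elim \<epsilon>)
        then have "\<epsilon> * (?P w * ?P z) > 0" using z(2) by simp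
        then have "\<forall>\<^sub>F R' in nhds (e + \<epsilon> *\<^sub>R z). ?P w * ?P R' > 0"
          using orient_arc_cone_0[OF c(2)] by (intro eventually_nhds_pos continuous_intros) (simp add: mult.left_commute)
        then show ?case
        proof eventually_elim
          case (elim R')
          have "?P R * ?P R' > 0" using elim R by (auto simp: zero_less_mult_iff)
          then have "0 < (k * k) * (?P R * ?P R')"
            using k(1) not_real_square_gt_zero[of k] mult_pos_pos by blast
          also have "\<dots> = orient u t R * orient u t R'" by (simp add: k(2))
          finally show ?case by (rule crossing_nonneg_same_side)
        qed
      qed
      then show ?case by blast
    qed
  next
    case apart
    have "\<forall>\<^sub>F R in nhds w. \<forall>\<^sub>F R' in nhds e. crossing R R' u t = 0"
    proof (rule crossing_eventually_0)
      fix \<alpha> \<beta> \<gamma> \<delta> :: real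
      assume nn: "\<alpha> \<ge> 0" "\<beta> \<ge> 0" "\<gamma> \<ge> 0" "\<delta> \<ge> 0" and eq: "\<alpha> *\<^sub>R w + \<beta> *\<^sub>R e = \<gamma> *\<^sub>R u + \<delta> *\<^sub>R t"
      have nzu: "cross3 u t \<noteq> 0" and nzw: "cross3 w e \<noteq> 0"
        using cross3_nonzero_piece[OF _ b(2,3)] cross3_nonzero_piece[OF _ a(2,3)] by simp_all
      \<comment> \<open>A common point with \<gamma> > 0 is interior to b. For \<alpha> > 0 it is
        also interior to a, and for \<alpha> = 0 it is a multiple of e, hence interior to c.\<close>
      have "\<gamma> = 0"
      proof (rule ccontr)
        assume "\<gamma> \<noteq> 0"
        then have in_b: "\<gamma> *\<^sub>R u + \<delta> *\<^sub>R t \<in> arc_cone b" using nn b by (intro arc_cone_combination) auto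
        show False
        proof (cases "\<alpha> = 0")
          case False
          then have "\<alpha> *\<^sub>R w + \<beta> *\<^sub>R e \<in> arc_cone a" using nn a by (intro arc_cone_combination) auto
          then show False using arc_cones_disjoint[OF a(1) b(1) _ in_b] eq apart(1) by simp
        next
          case True
          then have "\<beta> \<noteq> 0"
            using eq \<open>\<gamma> \<noteq> 0\<close> cross3_nonzero_imp_independent(1)[OF nzu, of \<gamma> \<delta>] by auto
          then have "\<beta> *\<^sub>R e + 0 *\<^sub>R fst c \<in> arc_cone c"
            using nn c by (intro arc_cone_combination) (auto simp: endpoints_def)
          then show False using arc_cones_disjoint[OF c(1) b(1) _ in_b] eq True apart(2) by simp
        qed
      qed
      moreover have "\<delta> = 0"
      proof (rule ccontr)
        assume "\<delta> \<noteq> 0"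
        have "t = inverse \<delta> *\<^sub>R (\<delta> *\<^sub>R t)" using \<open>\<delta> \<noteq> 0\<close> by simp
        also have "\<dots> = (inverse \<delta> * \<alpha>) *\<^sub>R w + (inverse \<delta> * \<beta>) *\<^sub>R e"
          using arg_cong[OF eq, of "\<lambda>x. inverse \<delta> *\<^sub>R x"] \<open>\<gamma> = 0\<close> by (simp add: scaleR_add_right)
        finally show False using apart(3)[of "inverse \<delta> * \<alpha>" "inverse \<delta> * \<beta>"] nn by simp
      qed
      moreover from calculation have "\<alpha> *\<^sub>R w + \<beta> *\<^sub>R e = 0" using eq by simp
      ultimately show "\<alpha> = 0 \<and> \<beta> = 0 \<and> \<gamma> = 0 \<and> \<delta> = 0"
        using cross3_nonzero_imp_independent[OF nzw] by blast
    qed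
    then show ?thesis
    proof eventually_elim
      case (elim R)
      then have "\<forall>\<^sub>F R' in nhds e. crossing R R' u t \<ge> 0" by (auto elim: eventually_mono)
      then show ?case using eventually_nhds_along_ray by blast
    qed
  qed
qed

lemma net_crossing_nonneg_along_arc:
  assumes "walk \<tau>" "a \<in> D" "w \<in> arc_cone a" "e \<in> endpoints a" "c \<in> D" "e \<in> arc_cone c"
    and z: "orient w e z < 0" "orient (fst c) (snd c) w * orient (fst c) (snd c) z > 0"
  shows "\<forall>\<^sub>F R in nhds w. orient w e R < 0 \<longrightarrow>
      (\<forall>\<^sub>F \<epsilon> in at_right 0. \<forall>\<^sub>F R' in nhds (e + \<epsilon> *\<^sub>R z). net_crossing \<tau> n R R' \<ge> 0)"
proof -
  have "\<forall>\<^sub>F R in nhds w. \<forall>k\<in>{..<n}. orient w e R < 0 \<longrightarrow>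
      (\<forall>\<^sub>F \<epsilon> in at_right 0. \<forall>\<^sub>F R' in nhds (e + \<epsilon> *\<^sub>R z). crossing R R' (snd (\<tau> k)) (snd (\<tau> (Suc k))) \<ge> 0)"
    using walkD[OF assms(1)]
    by (intro eventually_ball_finite finite_lessThan ballI crossing_nonneg_along_arc[OF assms(2-6) _ _ _ z])
  then show ?thesis
  proof eventually_elim
    case (elim R)
    show ?case
    proof
      assume "orient w e R < 0"
      then have "\<forall>\<^sub>F \<epsilon> in at_right 0. \<forall>k\<in>{..<n}. \<forall>\<^sub>F R' in nhds (e + \<epsilon> *\<^sub>R z). crossing R R' (snd (\<tau> k)) (snd (\<tau> (Suc k))) \<ge> 0"
        using elim by (intro eventually_ball_finite) auto
      then show "\<forall>\<^sub>F \<epsilon> in at_right 0. \<forall>\<^sub>F R' in nhds (e + \<epsilon> *\<^sub>R z). net_crossing \<tau> n R R' \<ge> 0"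
      proof eventually_elim
        case (elim \<epsilon>)
        then have "\<forall>\<^sub>F R' in nhds (e + \<epsilon> *\<^sub>R z). \<forall>k\<in>{..<n}. crossing R R' (snd (\<tau> k)) (snd (\<tau> (Suc k))) \<ge> 0"
          by (intro eventually_ball_finite) auto
        then show ?case
          by eventually_elim (auto simp: net_crossing_def intro: sum_nonneg)
      qed
    qed
  qed
qed

end

subsection \<open>Right turns\<close>

lemma eventually_cyclic_orbit:
  fixes h :: "'a \<Rightarrow> 'a"
  assumes "finite X" "\<And>x. x \<in> X \<Longrightarrow> h x \<in> X" "x \<in> X"
  obtains k n where "n > 0" "(h ^^ n) ((h ^^ k) x) = (h ^^ k) x" "inj_on (\<lambda>i. (h ^^ i) ((h ^^ k) x)) {..<n}"
proof -
  have "(h ^^ i) x \<in> X" for i by (induction i) (use assms in auto)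
  then have "finite (range (\<lambda>i. (h ^^ i) x))" using assms(1) by (auto intro: finite_subset)
  then have "\<not> inj (\<lambda>i. (h ^^ i) x)" using finite_imageD infinite_UNIV_nat by blast
  then obtain i j where ij: "(h ^^ i) x = (h ^^ j) x" "i < j"
    unfolding inj_def by (metis linorder_neqE_nat)
  let ?y = "(h ^^ i) x"
  define n where "n = (LEAST n. n > 0 \<and> (h ^^ n) ?y = ?y)"
  have "(h ^^ (j - i)) ?y = (h ^^ (j - i + i)) x" by (simp only: funpow_add comp_def)
  also have "\<dots> = ?y" using ij by simp
  finally have "(h ^^ (j - i)) ?y = ?y" .
  then have "j - i > 0 \<and> (h ^^ (j - i)) ?y = ?y" using ij(2) by simp
  then have n: "n > 0 \<and> (h ^^ n) ?y = ?y" unfolding n_def by (rule LeastI)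
  have "inj_on (\<lambda>k. (h ^^ k) ?y) {..<n}"
  proof (rule linorder_inj_onI)
    fix k l assume kl: "k < l" "k \<in> {..<n}" "l \<in> {..<n}"
    show "(h ^^ k) ?y \<noteq> (h ^^ l) ?y"
    proof
      assume eq: "(h ^^ k) ?y = (h ^^ l) ?y"
      have "(h ^^ (n - l + k)) ?y = (h ^^ (n - l)) ((h ^^ l) ?y)"
        by (simp add: funpow_add eq)
      also have "\<dots> = (h ^^ (n - l + l)) ?y" by (simp only: funpow_add comp_def)
      also have "\<dots> = ?y" using n kl by simp
      finally have "n - l + k > 0 \<and> (h ^^ (n - l + k)) ?y = ?y" using kl by simp
      then have "n \<le> n - l + k" unfolding n_def by (rule Least_le)
      then show False using kl by simp
    qed
  qed auto
  with n that show ?thesis by blast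
qed

context diagram
begin

definition blocker :: "point \<Rightarrow> arc" where
  "blocker e = (THE c. c \<in> D \<and> e \<in> arc_cone c)"

lemma blocker_eq: "c \<in> D \<Longrightarrow> e \<in> arc_cone c \<Longrightarrow> blocker e = c"
  unfolding blocker_def using arc_cones_disjoint by blast

lemma blocker:
  assumes "\<sigma> \<in> states"
  shows "blocker (snd \<sigma>) \<in> D" "snd \<sigma> \<in> arc_cone (blocker (snd \<sigma>))"
proof -
  have "fst \<sigma> \<in> D" "snd \<sigma> \<in> endpoints (fst \<sigma>)" using assms by (auto simp: states_def)
  then show "blocker (snd \<sigma>) \<in> D" "snd \<sigma> \<in> arc_cone (blocker (snd \<sigma>))"
    using endpoint_blocked blocker_eq by metis+
qed

definition source :: "arc \<times> point \<Rightarrow> point" where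
  "source \<sigma> = other_end (fst \<sigma>) (snd \<sigma>)"

definition right_turn :: "arc \<times> point \<Rightarrow> arc \<times> point" where
  "right_turn \<sigma> = (let c = blocker (snd \<sigma>) in
     (c, if orient (source \<sigma>) (snd \<sigma>) (fst c) < 0 then fst c else snd c))"

lemma statesD:
  assumes "\<sigma> \<in> states"
  shows "fst \<sigma> \<in> D" "snd \<sigma> \<in> endpoints (fst \<sigma>)" "is_arc (fst \<sigma>)"
  using assms is_arc_D by (auto simp: states_def)

lemma source_turn_nonzero:
  assumes "\<sigma> \<in> states" "c \<in> D" "snd \<sigma> \<in> arc_cone c" "t \<in> endpoints c"
  shows "orient (source \<sigma>) (snd \<sigma>) t \<noteq> 0"
proof -
  have "source \<sigma> + snd \<sigma> = 1 *\<^sub>R other_end (fst \<sigma>) (snd \<sigma>) + 1 *\<^sub>R snd \<sigma>" by (simp add: source_def)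
  then have "source \<sigma> + snd \<sigma> \<in> arc_cone (fst \<sigma>)"
    unfolding arc_cone_other_end[OF statesD(2)[OF assms(1)]] by (metis (mono_tags, lifting) mem_Collect_eq zero_less_one)
  from turn_nonzero[OF statesD(1)[OF assms(1)] this statesD(2)[OF assms(1)] assms(2-)]
  show ?thesis by simp
qed

text \<open>The determinant vanishes at the head, which lies strictly between the ends of c, so its
  values at those ends are negative multiples of each other.\<close>

lemma opposite_turns:
  assumes "\<sigma> \<in> states" "c \<in> D" "snd \<sigma> \<in> arc_cone c"
  shows "orient (source \<sigma>) (snd \<sigma>) (fst c) < 0 \<longleftrightarrow> orient (source \<sigma>) (snd \<sigma>) (snd c) > 0"
proof -
  let ?f = "orient (source \<sigma>) (snd \<sigma>)"
  obtain \<alpha> \<beta> where c: "\<alpha> > 0" "\<beta> > 0" "snd \<sigma> = \<alpha> *\<^sub>R fst c + \<beta> *\<^sub>R snd c"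
    using assms(3) by (auto simp: arc_cone_def)
  have "?f (\<alpha> *\<^sub>R fst c + \<beta> *\<^sub>R snd c) = 0" unfolding c(3)[symmetric] by simp
  then have "\<alpha> * ?f (fst c) = - (\<beta> * ?f (snd c))" by (simp add: eq_neg_iff_add_eq_0)
  then have "\<alpha> * ?f (fst c) < 0 \<longleftrightarrow> \<beta> * ?f (snd c) > 0" by auto
  then show ?thesis using c by (simp add: mult_less_0_iff zero_less_mult_iff)
qed

lemma right_turn:
  assumes "\<sigma> \<in> states"
  shows "right_turn \<sigma> \<in> states" "snd \<sigma> \<in> arc_cone (fst (right_turn \<sigma>))"
    "orient (source \<sigma>) (snd \<sigma>) (snd (right_turn \<sigma>)) < 0"
proof -
  note b = blocker[OF assms]
  show "right_turn \<sigma> \<in> states" "snd \<sigma> \<in> arc_cone (fst (right_turn \<sigma>))"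
    using b by (auto simp: right_turn_def Let_def states_def endpoints_def)
  have "orient (source \<sigma>) (snd \<sigma>) (snd (blocker (snd \<sigma>))) \<noteq> 0"
    by (rule source_turn_nonzero[OF assms b]) (simp add: endpoints_def)
  then show "orient (source \<sigma>) (snd \<sigma>) (snd (right_turn \<sigma>)) < 0"
    using opposite_turns[OF assms b] by (auto simp: right_turn_def Let_def)
qed

lemma right_turn_unique:
  assumes "\<sigma> \<in> states" "c \<in> D" "snd \<sigma> \<in> arc_cone c" "t \<in> endpoints c" "orient (source \<sigma>) (snd \<sigma>) t < 0"
  shows "right_turn \<sigma> = (c, t)"
proof -
  have "t = fst c \<or> t = snd c" using assms(4) by (simp add: endpoints_def)
  then show ?thesis
    using blocker_eq[OF assms(2,3)] opposite_turns[OF assms(1-3)] assms(5)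
    by (auto simp: right_turn_def Let_def)
qed

lemma source_direction:
  assumes "\<sigma> \<in> states" "w \<in> arc_cone (fst \<sigma>)"
  obtains k where "k > 0" "\<And>X. orient w (snd \<sigma>) X = k * orient (source \<sigma>) (snd \<sigma>) X"
  using orient_arc_cone_other_end[OF assms(2) statesD(2)[OF assms(1)]] unfolding source_def by metis

text \<open>A direction at the head of \<sigma> into the wedge to the right of both \<sigma> and its
  continuation; a point following the walk on its right side passes through this wedge.\<close>

definition corner :: "arc \<times> point \<Rightarrow> point \<Rightarrow> bool" where
  "corner \<sigma> z \<longleftrightarrow> orient (source \<sigma>) (snd \<sigma>) z < 0 \<and> orient (snd \<sigma>) (snd (right_turn \<sigma>)) z < 0"

text \<open>The directions back along \<sigma> and forward along the next arc bound the wedge, so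
  their sum lies inside it.\<close>

lemma corner_eventually:
  assumes "\<sigma> \<in> states"
  shows "\<forall>\<^sub>F z in nhds (source \<sigma> + snd (right_turn \<sigma>)). corner \<sigma> z"
  unfolding corner_def
proof (rule eventually_conj; rule eventually_nhds_neg)
  show "orient (snd \<sigma>) (snd (right_turn \<sigma>)) (source \<sigma> + snd (right_turn \<sigma>)) < 0"
    using right_turn(3)[OF assms] by (simp add: orient_cycle orient_cycle')
qed (use right_turn(3)[OF assms] in \<open>auto intro: continuous_intros\<close>)

lemma net_crossing_nonneg_right_of_state:
  assumes "walk \<tau>" "\<sigma> \<in> states" "w \<in> arc_cone (fst \<sigma>)" "corner \<sigma> z"
  shows "\<forall>\<^sub>F R in nhds w. orient w (snd \<sigma>) R < 0 \<longrightarrow>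
      (\<forall>\<^sub>F \<epsilon> in at_right 0. \<forall>\<^sub>F R' in nhds (snd \<sigma> + \<epsilon> *\<^sub>R z). net_crossing \<tau> n R R' \<ge> 0)"
proof (rule net_crossing_nonneg_along_arc[OF assms(1) statesD(1)[OF assms(2)] assms(3) statesD(2)[OF assms(2)]])
  let ?c = "fst (right_turn \<sigma>)"
  let ?P = "orient (fst ?c) (snd ?c)"
  note rt = right_turn[OF assms(2)]
  show "?c \<in> D" "snd \<sigma> \<in> arc_cone ?c" using rt(1,2) statesD by auto
  obtain k where k: "k > 0" "\<And>X. orient w (snd \<sigma>) X = k * orient (source \<sigma>) (snd \<sigma>) X"
    using source_direction[OF assms(2,3)] by blast
  show "orient w (snd \<sigma>) z < 0"
    using assms(4) k by (simp add: corner_def mult_pos_neg)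
  obtain l where l: "l \<noteq> 0" "\<And>X. orient (snd \<sigma>) (snd (right_turn \<sigma>)) X = l * ?P X"
    using orient_arc[OF rt(2) statesD(2)[OF rt(1)]] by blast
  have "orient w (snd \<sigma>) (snd (right_turn \<sigma>)) < 0" using rt(3) k by (simp add: mult_pos_neg)
  then have "l * ?P w < 0" unfolding l(2)[symmetric] by (simp add: orient_cycle orient_cycle')
  moreover have "l * ?P z < 0" using assms(4) unfolding l(2)[symmetric] corner_def by simp
  ultimately have "0 < (l * ?P w) * (l * ?P z)" by (rule mult_neg_neg)
  also have "\<dots> = (l * l) * (?P w * ?P z)" by simp
  finally show "0 < ?P w * ?P z" using not_real_square_gt_zero[of l] l(1) by (simp add: zero_less_mult_iff)
qed

text \<open>The potential at q is at least that at p; the first two clauses are the general position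
  that the triangle identity demands of q in the next step.\<close>

definition reached :: "(nat \<Rightarrow> arc \<times> point) \<Rightarrow> nat \<Rightarrow> point \<Rightarrow> point \<Rightarrow> bool" where
  "reached \<tau> n p q \<longleftrightarrow> (\<forall>j. orient (snd (\<tau> j)) (snd (\<tau> (Suc j))) q \<noteq> 0) \<and>
     (\<forall>j. orient p (snd (\<tau> j)) q \<noteq> 0) \<and> net_crossing \<tau> n p q \<ge> 0"

text \<open>A statement of the kind "frequently": reached points meet every set that contains all
  points deep enough in the corner, so further eventual conditions can be imposed on them.\<close>

definition corner_reached :: "(nat \<Rightarrow> arc \<times> point) \<Rightarrow> nat \<Rightarrow> point \<Rightarrow> arc \<times> point \<Rightarrow> point \<Rightarrow> bool" where
  "corner_reached \<tau> n p \<sigma> z \<longleftrightarrow>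
     (\<forall>P. (\<forall>\<^sub>F \<epsilon> in at_right 0. \<forall>\<^sub>F q in nhds (snd \<sigma> + \<epsilon> *\<^sub>R z). P q) \<longrightarrow> (\<exists>q. P q \<and> reached \<tau> n p q))"

lemma walk_vertices_finite:
  assumes "walk \<tau>"
  shows "finite (range (\<lambda>j. snd (\<tau> j)))"
  by (rule finite_subset[of _ "snd ` states"]) (use assms finite_states in \<open>auto simp: walk_def\<close>)

lemma walk_generic_point:
  assumes "walk \<tau>" "\<forall>\<^sub>F q in nhds q0. P q" "finite X" "\<And>a b. (a, b) \<in> X \<Longrightarrow> cross3 a b \<noteq> 0"
    "finite Y" "\<And>y j. y \<in> Y \<Longrightarrow> orient (snd (\<tau> j)) (snd (\<tau> (Suc j))) y \<noteq> 0"
  obtains q where "P q" "\<And>j. orient (snd (\<tau> j)) (snd (\<tau> (Suc j))) q \<noteq> 0"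
    "\<And>a b. (a, b) \<in> X \<Longrightarrow> orient a b q \<noteq> 0" "\<And>y j. y \<in> Y \<Longrightarrow> orient y (snd (\<tau> j)) q \<noteq> 0"
proof -
  let ?V = "range (\<lambda>j. snd (\<tau> j))"
  let ?E = "range (\<lambda>j. (snd (\<tau> j), snd (\<tau> (Suc j))))"
  let ?X = "X \<union> ?E \<union> Y \<times> ?V"
  have fin: "finite ?V" by (rule walk_vertices_finite[OF assms(1)])
  have "?E \<subseteq> ?V \<times> ?V" by auto
  then have "finite ?E" by (rule finite_subset) (use fin in simp)
  then have finX: "finite ?X" using assms(3,5) fin by simp
  have X: "cross3 a b \<noteq> 0" if ab: "(a, b) \<in> ?X" for a b
  proof -
    consider "(a, b) \<in> X" | "(a, b) \<in> ?E" | j where "a \<in> Y" "b = snd (\<tau> j)"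
      using ab by fast
    then show ?thesis
    proof cases
      case 3
      then have "orient a b (snd (\<tau> (Suc j))) \<noteq> 0" using assms(6)[of a j] by (simp add: orient_cycle orient_cycle')
      then show ?thesis by (auto simp: orient_def)
    qed (use assms(4) walk_piece_nonzero[OF assms(1)] in auto)
  qed
  show ?thesis
  proof (rule generic_point[OF assms(2) finX X])
    fix q assume "P q" "\<And>a b. (a, b) \<in> ?X \<Longrightarrow> orient a b q \<noteq> 0"
    then show ?thesis by (intro that[of q]) auto
  qed
qed

text \<open>For generic q in the corner, the triangle p, R, q adds two nonnegative differences. The
  case \<open>R = p\<close> starts the propagation.\<close>

lemma corner_reachedI:
  assumes "closed_walk \<tau> n" and p: "\<And>j. orient (snd (\<tau> j)) (snd (\<tau> (Suc j))) p \<noteq> 0"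
    and R: "R = p \<or> reached \<tau> n p R"
    and ev: "\<forall>\<^sub>F \<epsilon> in at_right 0. \<forall>\<^sub>F R' in nhds (snd \<sigma> + \<epsilon> *\<^sub>R z). net_crossing \<tau> n R R' \<ge> 0"
  shows "corner_reached \<tau> n p \<sigma> z"
  unfolding corner_reached_def
proof (intro allI impI)
  fix P assume P: "\<forall>\<^sub>F \<epsilon> in at_right 0. \<forall>\<^sub>F q in nhds (snd \<sigma> + \<epsilon> *\<^sub>R z). P q"
  have w: "walk \<tau>" using assms(1) by (simp add: closed_walk_def)
  have "\<forall>\<^sub>F \<epsilon> in at_right 0. \<forall>\<^sub>F q in nhds (snd \<sigma> + \<epsilon> *\<^sub>R z). P q \<and> net_crossing \<tau> n R q \<ge> 0"
    using P ev by eventually_elim (rule eventually_conj)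
  then obtain \<epsilon> where \<epsilon>: "\<forall>\<^sub>F q in nhds (snd \<sigma> + \<epsilon> *\<^sub>R z). P q \<and> net_crossing \<tau> n R q \<ge> 0"
    using eventually_happens trivial_limit_at_right_real by blast
  let ?X = "if R = p then {} else {(p, R)}"
  have X: "cross3 a b \<noteq> 0" if "(a, b) \<in> ?X" for a b
  proof -
    have ab: "a = p" "b = R" "reached \<tau> n p R" using that R by (auto split: if_splits)
    then have "orient p R (snd (\<tau> 0)) \<noteq> 0" using orient_swap(2)[of p R] by (simp add: reached_def)
    then show ?thesis using ab by (auto simp: orient_def)
  qed
  have Y: "orient (snd (\<tau> j)) (snd (\<tau> (Suc j))) y \<noteq> 0" if "y \<in> {p, R}" for y j
    using that p R by (auto simp: reached_def)
  obtain q where q: "P q \<and> net_crossing \<tau> n R q \<ge> 0"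
      "\<And>j. orient (snd (\<tau> j)) (snd (\<tau> (Suc j))) q \<noteq> 0"
      "\<And>a b. (a, b) \<in> ?X \<Longrightarrow> orient a b q \<noteq> 0" "\<And>y j. y \<in> {p, R} \<Longrightarrow> orient y (snd (\<tau> j)) q \<noteq> 0"
    by (rule walk_generic_point[OF w \<epsilon>, of ?X "{p, R}"]) (use X Y in \<open>auto split: if_splits\<close>)
  have "net_crossing \<tau> n p q \<ge> 0"
  proof (cases "R = p")
    case False
    then have r: "reached \<tau> n p R" using R by simp
    have "net_crossing \<tau> n p R + net_crossing \<tau> n R q + net_crossing \<tau> n q p = 0"
    proof (rule net_crossing_triangle[OF assms(1)])
      show "orient p R q \<noteq> 0" using q(3) False by simp
      show "orient p R (snd (\<tau> k)) \<noteq> 0" for k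
        using r orient_swap(2)[of p R] by (simp add: reached_def)
      show "orient R q (snd (\<tau> k)) \<noteq> 0" for k
        using q(4)[of R k] orient_swap(2)[of R q] by simp
      show "orient q p (snd (\<tau> k)) \<noteq> 0" for k
        using q(4)[of p k] by (simp add: orient_cycle orient_cycle')
    qed (use p q(2) r in \<open>auto simp: reached_def\<close>)
    then show ?thesis using q(1) r net_crossing_commute[of \<tau> n p q] by (simp add: reached_def)
  qed (use q(1) in simp)
  then show "\<exists>q. P q \<and> reached \<tau> n p q" using q unfolding reached_def by blast
qed

text \<open>A point in the corner of \<sigma> lies to the right of the next arc and close to the hit
  point, which is where the passage to the following corner starts.\<close>

lemma corner_reached_step:
  assumes "closed_walk \<tau> n" and p: "\<And>j. orient (snd (\<tau> j)) (snd (\<tau> (Suc j))) p \<noteq> 0"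
    and \<sigma>: "\<sigma> \<in> states" "corner \<sigma> z" "corner_reached \<tau> n p \<sigma> z" and z': "corner (right_turn \<sigma>) z'"
  shows "corner_reached \<tau> n p (right_turn \<sigma>) z'"
proof -
  let ?\<sigma>' = "right_turn \<sigma>"
  let ?w = "snd \<sigma>"
  note rt = right_turn[OF \<sigma>(1)]
  have w: "walk \<tau>" using assms(1) by (simp add: closed_walk_def)
  let ?Q = "\<lambda>R. \<forall>\<^sub>F \<epsilon> in at_right 0. \<forall>\<^sub>F R' in nhds (snd ?\<sigma>' + \<epsilon> *\<^sub>R z'). net_crossing \<tau> n R R' \<ge> 0"
  have "\<forall>\<^sub>F \<epsilon> in at_right 0. \<forall>\<^sub>F R in nhds (?w + \<epsilon> *\<^sub>R z). orient ?w (snd ?\<sigma>') R < 0 \<longrightarrow> ?Q R"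
    using net_crossing_nonneg_right_of_state[OF w rt(1) rt(2) z'] by (rule eventually_nhds_along_ray)
  then have "\<forall>\<^sub>F \<epsilon> in at_right 0. \<forall>\<^sub>F R in nhds (?w + \<epsilon> *\<^sub>R z). ?Q R"
    using eventually_at_right_less[of "0::real"]
  proof eventually_elim
    case (elim \<epsilon>)
    have "\<forall>\<^sub>F R in nhds (?w + \<epsilon> *\<^sub>R z). orient ?w (snd ?\<sigma>') R < 0"
      using elim(2) \<sigma>(2) by (intro eventually_nhds_neg continuous_intros) (simp add: corner_def mult_pos_neg)
    with elim(1) show ?case by eventually_elim blast
  qed
  then obtain R where "?Q R" "reached \<tau> n p R"
    using \<sigma>(3) unfolding corner_reached_def by blast
  then show ?thesis using corner_reachedI[OF assms(1) p] by blast
qed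

end

subsection \<open>Right-turning walks avoiding a given state\<close>

context diagram
begin

text \<open>The side of \<open>m\<close>, perturbed infinitesimally towards \<open>z\<close>.\<close>

definition on_left :: "point \<Rightarrow> point \<Rightarrow> point \<Rightarrow> point \<Rightarrow> bool" where
  "on_left m z e t \<longleftrightarrow> orient e t m > 0 \<or> orient e t m = 0 \<and> orient e t z > 0"

definition left_step :: "point \<Rightarrow> point \<Rightarrow> arc \<times> point \<Rightarrow> arc \<times> point" where
  "left_step m z \<sigma> = (let c = blocker (snd \<sigma>) in (c, if on_left m z (snd \<sigma>) (fst c) then fst c else snd c))"

text \<open>The two directions on the blocker give determinants of opposite sign. If m lies in its
  plane, z decides, as z lies in the plane of no arc.\<close>

lemma left_step:
  assumes "\<sigma> \<in> states" "\<And>c. c \<in> D \<Longrightarrow> orient (fst c) (snd c) z \<noteq> 0"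
  shows "left_step m z \<sigma> \<in> states" "snd \<sigma> \<in> arc_cone (fst (left_step m z \<sigma>))"
    "on_left m z (snd \<sigma>) (snd (left_step m z \<sigma>))"
proof -
  note b = blocker[OF assms(1)]
  let ?c = "blocker (snd \<sigma>)"
  show "left_step m z \<sigma> \<in> states" "snd \<sigma> \<in> arc_cone (fst (left_step m z \<sigma>))"
    using b by (auto simp: left_step_def Let_def states_def endpoints_def)
  obtain \<alpha> \<beta> where c: "\<alpha> > 0" "\<beta> > 0" "snd \<sigma> = \<alpha> *\<^sub>R fst ?c + \<beta> *\<^sub>R snd ?c"
    using b(2) by (auto simp: arc_cone_def)
  have 1: "orient (snd \<sigma>) (fst ?c) X = - (\<beta> * orient (fst ?c) (snd ?c) X)" for X
    by (subst c(3)) (simp add: orient_swap(1)[of "snd ?c" "fst ?c"])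
  have 2: "orient (snd \<sigma>) (snd ?c) X = \<alpha> * orient (fst ?c) (snd ?c) X" for X
    by (subst c(3)) simp
  have "on_left m z (snd \<sigma>) (fst ?c) \<or> on_left m z (snd \<sigma>) (snd ?c)"
    using assms(2)[OF b(1)] c(1,2) unfolding on_left_def 1 2
    by (auto simp: mult_less_0_iff zero_less_mult_iff linorder_neq_iff)
  then show "on_left m z (snd \<sigma>) (snd (left_step m z \<sigma>))"
    by (auto simp: left_step_def Let_def)
qed

lemma closed_walk_shift:
  assumes "closed_walk \<tau> n"
  shows "\<tau> (i + l * n) = \<tau> i"
proof (induction l)
  case (Suc l)
  have "\<tau> (i + Suc l * n) = \<tau> ((i + l * n) + n)" by (simp add: algebra_simps)
  also have "\<dots> = \<tau> (i + l * n)" using assms unfolding closed_walk_def by blast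
  finally show ?case using Suc by simp
qed simp

lemma iterate_walk:
  assumes "\<sigma> \<in> states" "\<And>\<sigma>. \<sigma> \<in> states \<Longrightarrow> h \<sigma> \<in> states" "\<And>\<sigma>. \<sigma> \<in> states \<Longrightarrow> snd \<sigma> \<in> arc_cone (fst (h \<sigma>))"
  shows "walk (\<lambda>i. (h ^^ i) \<sigma>)"
proof -
  have "(h ^^ i) \<sigma> \<in> states" for i by (induction i) (use assms in auto)
  then show ?thesis using assms(3) by (simp add: walk_def)
qed

lemma eventual_closed_walk:
  assumes "\<sigma> \<in> states" "\<And>\<sigma>. \<sigma> \<in> states \<Longrightarrow> h \<sigma> \<in> states" "\<And>\<sigma>. \<sigma> \<in> states \<Longrightarrow> snd \<sigma> \<in> arc_cone (fst (h \<sigma>))"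
  obtains k n where "closed_walk (\<lambda>i. (h ^^ i) ((h ^^ k) \<sigma>)) n" "inj_on (\<lambda>i. (h ^^ i) ((h ^^ k) \<sigma>)) {..<n}"
proof -
  obtain k n where kn: "n > 0" "(h ^^ n) ((h ^^ k) \<sigma>) = (h ^^ k) \<sigma>" "inj_on (\<lambda>i. (h ^^ i) ((h ^^ k) \<sigma>)) {..<n}"
    by (rule eventually_cyclic_orbit[OF finite_states assms(2,1)])
  have "(h ^^ k) \<sigma> \<in> states" by (induction k) (use assms in auto)
  then have "walk (\<lambda>i. (h ^^ i) ((h ^^ k) \<sigma>))" using assms by (intro iterate_walk)
  moreover have "(h ^^ (i + n)) ((h ^^ k) \<sigma>) = (h ^^ i) ((h ^^ k) \<sigma>)" for i
    unfolding funpow_add[of i n] comp_def kn(2) ..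
  ultimately have "closed_walk (\<lambda>i. (h ^^ i) ((h ^^ k) \<sigma>)) n"
    unfolding closed_walk_def using kn(1) by blast
  with that kn(3) show ?thesis by blast
qed

lemma walk_turn_nonzero:
  assumes "walk \<tau>"
  shows "orient (snd (\<tau> i)) (snd (\<tau> (Suc i))) (snd (\<tau> (Suc (Suc i)))) \<noteq> 0"
  by (rule turn_nonzero[of "fst (\<tau> (Suc i))" _ _ "fst (\<tau> (Suc (Suc i)))"]) (use walkD[OF assms] in auto)

text \<open>The planes of consecutive pieces meet only in the line of their common vertex, so a
  vector in all of them would be a multiple of two independent vertices.\<close>

lemma walk_noncoplanar_piece:
  assumes "walk \<tau>" "m \<noteq> 0"
  obtains k where "orient (snd (\<tau> k)) (snd (\<tau> (Suc k))) m \<noteq> 0"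
proof (rule ccontr)
  let ?v = "\<lambda>k. snd (\<tau> k)"
  assume "\<not> thesis"
  then have 0: "orient (?v k) (?v (Suc k)) m = 0" for k using that by blast
  have "\<exists>b. m = b *\<^sub>R ?v (Suc k)" for k
  proof -
    have "orient m (?v k) (?v (Suc k)) = 0" using 0[of k] orient_cycle'[of m] by metis
    then obtain a b where m: "m = a *\<^sub>R ?v k + b *\<^sub>R ?v (Suc k)"
      using coplanar_imp_combination walk_piece_nonzero[OF assms(1)] by metis
    have "0 = orient (?v (Suc k)) (?v (Suc (Suc k))) m" using 0 by simp
    also have "\<dots> = a * orient (?v k) (?v (Suc k)) (?v (Suc (Suc k)))"
      unfolding m using orient_cycle[of "?v (Suc k)" "?v (Suc (Suc k))" "?v k"] by simp
    finally have "a = 0" using walk_turn_nonzero[OF assms(1), of k] by simp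
    then show ?thesis using m by auto
  qed
  then obtain b b' where "m = b *\<^sub>R ?v 1" "m = b' *\<^sub>R ?v 2"
    by (metis One_nat_def numeral_2_eq_2)
  then have "b *\<^sub>R ?v 1 + (- b') *\<^sub>R ?v (Suc 1) = 0" by (simp add: numeral_2_eq_2)
  from cross3_nonzero_imp_independent(1)[OF walk_piece_nonzero[OF assms(1)] this]
  show False using assms(2) \<open>m = b *\<^sub>R ?v 1\<close> by simp
qed

text \<open>Take a closed walk \<open>\<tau>\<close> that keeps on its left a point just inside the corner of \<open>\<sigma>\<close>. Entering
  that corner from the right side of \<open>\<tau>\<close> means crossing \<open>\<tau>\<close> from right to left on balance, while
  moving along right turns only ever crosses it from left to right.\<close>

lemma right_turns_avoid_state:
  assumes "\<sigma> \<in> states"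
  obtains \<rho> where "\<rho> \<in> states" "\<And>i. (right_turn ^^ Suc i) \<rho> \<noteq> \<sigma>"
proof -
  let ?m = "snd \<sigma>"
  have "\<exists>z. corner \<sigma> z \<and> (\<forall>c\<in>D. orient (fst c) (snd c) z \<noteq> 0)"
  proof -
    have "cross3 a b \<noteq> 0" if "(a, b) \<in> D" for a b
      using arc_cross3_nonzero[OF is_arc_D[OF that]] by simp
    from generic_point[OF corner_eventually[OF assms] finite_D this]
    obtain z where "corner \<sigma> z" "\<And>a b. (a, b) \<in> D \<Longrightarrow> orient a b z \<noteq> 0" by blast
    then show ?thesis by (metis prod.collapse)
  qed
  then obtain z where z: "corner \<sigma> z" "\<And>c. c \<in> D \<Longrightarrow> orient (fst c) (snd c) z \<noteq> 0" by blast
  \<comment> \<open>With the head of \<sigma> as target and z as tie-break, points just inside the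
    corner of \<sigma> lie to the left of every piece of the resulting closed walk.\<close>
  let ?h = "left_step ?m z"
  note ls = left_step[OF _ z(2), of _ ?m]
  obtain k n where cw: "closed_walk (\<lambda>i. (?h ^^ i) ((?h ^^ k) \<sigma>)) n"
    using eventual_closed_walk[OF assms, of ?h] ls(1,2) by metis
  define \<tau> where "\<tau> = (\<lambda>i. (?h ^^ i) ((?h ^^ k) \<sigma>))"
  let ?v = "\<lambda>i. snd (\<tau> i)"
  have cw: "closed_walk \<tau> n" using cw unfolding \<tau>_def .
  then have w: "walk \<tau>" by (simp add: closed_walk_def)
  have left: "on_left ?m z (?v i) (?v (Suc i))" for i
  proof -
    have "\<tau> i \<in> states" using w by (simp add: walk_def)
    then show ?thesis using ls(3)[of "\<tau> i"] by (simp add: \<tau>_def)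
  qed
  have "norm ?m = 1" using endpoint_norm[OF statesD(1,2)[OF assms]] .
  then have "?m \<noteq> 0" by auto
  \<comment> \<open>Piece j has the head of \<sigma> strictly to its left. The base point p is
    placed just to the right of the interior point ?M of this piece and within the angle under which
    the piece appears from that head, so that the segment from the corner to p crosses it.\<close>
  then obtain j where j: "orient (?v j) (?v (Suc j)) ?m \<noteq> 0"
    using walk_noncoplanar_piece[OF w] by blast
  let ?\<rho> = "\<tau> (Suc j)"
  let ?u = "?v j" and ?t = "?v (Suc j)"
  let ?M = "?u + ?t"
  have pos: "orient ?u ?t ?m > 0" using j left[of j] by (auto simp: on_left_def)
  have \<rho>: "?\<rho> \<in> states" using w by (simp add: walk_def)
  have "1 *\<^sub>R ?u + 1 *\<^sub>R ?t \<in> arc_cone (fst ?\<rho>)"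
    by (intro arc_cone_combination) (use walkD[OF w] in auto)
  then have M: "?M \<in> arc_cone (fst ?\<rho>)" by simp
  obtain z0 where z0: "corner ?\<rho> z0"
    using corner_eventually[OF \<rho>] eventually_nhds_x_imp_x by blast
  let ?Q = "\<lambda>R. \<forall>\<^sub>F \<epsilon> in at_right 0. \<forall>\<^sub>F R' in nhds (?t + \<epsilon> *\<^sub>R z0). net_crossing \<tau> n R R' \<ge> 0"
  obtain \<kappa> where \<kappa>: "\<kappa> > 0" "\<And>X. orient ?M ?t X = \<kappa> * orient (source ?\<rho>) ?t X"
    using source_direction[OF \<rho> M] by blast
  have "orient ?M ?t z0 < 0" using z0 \<kappa> by (simp add: corner_def mult_pos_neg)
  then have z0': "orient ?u ?t z0 < 0" by simp
  have "\<forall>\<^sub>F \<epsilon> in at_right 0. \<forall>\<^sub>F R in nhds (?M + \<epsilon> *\<^sub>R z0). orient ?M ?t R < 0 \<longrightarrow> ?Q R"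
    using net_crossing_nonneg_right_of_state[OF w \<rho> M z0] by (rule eventually_nhds_along_ray)
  moreover have "\<forall>\<^sub>F \<epsilon> in at_right 0. \<forall>\<^sub>F R in nhds (?M + \<epsilon> *\<^sub>R z0). orient ?u ?m R < 0"
    using pos orient_swap(2)[of ?u ?m ?t]
    by (intro eventually_nhds_along_ray eventually_nhds_neg continuous_intros) simp_all
  moreover have "\<forall>\<^sub>F \<epsilon> in at_right 0. \<forall>\<^sub>F R in nhds (?M + \<epsilon> *\<^sub>R z0). orient ?m ?t R < 0"
    using pos orient_swap(3)[of ?u ?t ?m]
    by (intro eventually_nhds_along_ray eventually_nhds_neg continuous_intros) (simp_all add: orient_swap(3)[of ?u ?t ?m])
  ultimately have "\<forall>\<^sub>F \<epsilon> in at_right 0. \<forall>\<^sub>F R in nhds (?M + \<epsilon> *\<^sub>R z0).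
      ?Q R \<and> orient ?u ?m R < 0 \<and> orient ?m ?t R < 0 \<and> orient ?u ?t R < 0"
    using eventually_at_right_less[of "0::real"]
  proof eventually_elim
    case (elim \<epsilon>)
    have "\<forall>\<^sub>F R in nhds (?M + \<epsilon> *\<^sub>R z0). orient ?u ?t R < 0"
      using elim(4) z0' by (intro eventually_nhds_neg continuous_intros) (simp add: mult_pos_neg)
    with elim(1-3) show ?case by eventually_elim simp
  qed
  then obtain \<epsilon> where "\<forall>\<^sub>F R in nhds (?M + \<epsilon> *\<^sub>R z0).
      ?Q R \<and> orient ?u ?m R < 0 \<and> orient ?m ?t R < 0 \<and> orient ?u ?t R < 0"
    using eventually_happens trivial_limit_at_right_real by blast
  then obtain p where p: "?Q p" "orient ?u ?m p < 0" "orient ?m ?t p < 0" "orient ?u ?t p < 0"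
      "\<And>i. orient (?v i) (?v (Suc i)) p \<noteq> 0"
    by (rule walk_generic_point[OF w, of _ _ "{}" "{}"]) auto
  have base: "corner_reached \<tau> n p ?\<rho> z0"
    using corner_reachedI[OF cw p(5)] p(1) by blast
  \<comment> \<open>Every piece keeps x on its left, so none counts -1 on the way from x to p, and
    piece j counts 1.\<close>
  have near: "\<forall>\<^sub>F \<epsilon> in at_right 0. \<forall>\<^sub>F x in nhds (?m + \<epsilon> *\<^sub>R z). net_crossing \<tau> n x p \<ge> 1"
  proof -
    have "\<forall>\<^sub>F \<epsilon> in at_right 0. \<forall>\<^sub>F x in nhds (?m + \<epsilon> *\<^sub>R z). orient (?v i) (?v (Suc i)) x > 0" for i
    proof (cases "orient (?v i) (?v (Suc i)) ?m > 0")
      case True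
      then show ?thesis
        by (intro eventually_nhds_along_ray eventually_nhds_pos continuous_intros)
    next
      case False
      then have 0: "orient (?v i) (?v (Suc i)) ?m = 0" "orient (?v i) (?v (Suc i)) z > 0"
        using left[of i] by (auto simp: on_left_def)
      show ?thesis
        using eventually_at_right_less[of "0::real"]
        by eventually_elim (use 0 in \<open>auto intro!: eventually_nhds_pos continuous_intros\<close>)
    qed
    \<comment> \<open>The bound covers the n summands as well as piece j, whose index need not be
      below n.\<close>
    then have "\<forall>\<^sub>F \<epsilon> in at_right 0. \<forall>i\<in>{..<n + Suc j}. \<forall>\<^sub>F x in nhds (?m + \<epsilon> *\<^sub>R z). orient (?v i) (?v (Suc i)) x > 0"
      by (intro eventually_ball_finite) auto
    moreover have "\<forall>\<^sub>F \<epsilon> in at_right 0. \<forall>\<^sub>F x in nhds (?m + \<epsilon> *\<^sub>R z). orient x p ?u < 0"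
      using p(2) orient_cycle[of ?m p ?u]
      by (intro eventually_nhds_along_ray eventually_nhds_neg continuous_intros) simp
    moreover have "\<forall>\<^sub>F \<epsilon> in at_right 0. \<forall>\<^sub>F x in nhds (?m + \<epsilon> *\<^sub>R z). orient x p ?t > 0"
      using p(3) orient_swap(2)[of ?m p ?t]
      by (intro eventually_nhds_along_ray eventually_nhds_pos continuous_intros) simp
    ultimately show ?thesis
    proof eventually_elim
      case (elim \<epsilon>)
      have "\<forall>\<^sub>F x in nhds (?m + \<epsilon> *\<^sub>R z). \<forall>i\<in>{..<n + Suc j}. orient (?v i) (?v (Suc i)) x > 0"
        using elim(1) by (intro eventually_ball_finite) auto
      with elim(2,3) show ?case
      proof eventually_elim
        case (elim x)
        have nn: "crossing x p (?v i) (?v (Suc i)) \<ge> 0" if "i < n + Suc j" for i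
          using elim(3) that by (intro crossing_nonneg) (auto intro: less_imp_le)
        have "crossing x p ?u ?t = 1"
          using elim p(4) by (simp add: crossing_def)
        moreover have "\<tau> (j mod n) = \<tau> j" "\<tau> (Suc (j mod n)) = \<tau> (Suc j)"
        proof -
          show "\<tau> (j mod n) = \<tau> j" "\<tau> (Suc (j mod n)) = \<tau> (Suc j)"
            using closed_walk_shift[OF cw, of "j mod n" "j div n"] closed_walk_shift[OF cw, of "Suc (j mod n)" "j div n"]
            by simp_all
        qed
        ultimately have "crossing x p (?v (j mod n)) (?v (Suc (j mod n))) = 1" by simp
        moreover have "j mod n < n" using cw by (simp add: closed_walk_def)
        moreover have "crossing x p (?v (j mod n)) (?v (Suc (j mod n))) \<le> net_crossing \<tau> n x p"
          unfolding net_crossing_def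
          by (rule member_le_sum) (use nn \<open>j mod n < n\<close> in auto)
        ultimately show ?case by simp
      qed
    qed
  qed
  \<comment> \<open>Intermediate corner directions are arbitrary, but the last step must end with
    the z that defines the closed walk; hence a positive iterate.\<close>
  have "(right_turn ^^ Suc i) ?\<rho> \<noteq> \<sigma>" for i
  proof
    let ?f = "\<lambda>i. (right_turn ^^ i) ?\<rho>"
    assume eq: "?f (Suc i) = \<sigma>"
    have st: "?f i \<in> states" for i by (induction i) (use \<rho> right_turn in auto)
    have "\<exists>z. corner (?f i) z \<and> corner_reached \<tau> n p (?f i) z" for i
    proof (induction i)
      case 0
      then show ?case using z0 base by auto
    next
      case (Suc i)
      then obtain y where y: "corner (?f i) y" "corner_reached \<tau> n p (?f i) y" by blast
      obtain y' where "corner (?f (Suc i)) y'"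
        using corner_eventually[OF st] eventually_nhds_x_imp_x by blast
      with corner_reached_step[OF cw p(5) st y] show ?case by auto
    qed
    then obtain y where y: "corner (?f i) y" "corner_reached \<tau> n p (?f i) y" by blast
    have "corner_reached \<tau> n p \<sigma> z"
      using corner_reached_step[OF cw p(5) st y] z(1) eq by simp
    with near obtain q where "net_crossing \<tau> n q p \<ge> 1" "reached \<tau> n p q"
      unfolding corner_reached_def by blast
    then show False using net_crossing_commute[of \<tau> n q p] by (simp add: reached_def)
  qed
  with \<rho> that show ?thesis by blast
qed

end

subsection \<open>Convexity of right-turning cycles\<close>

context diagram
begin

text \<open>Crossing the walk from left to right raises the potential \<open>net_crossing \<tau> n y\<close>; the point \<open>x\<close> is
  a generic maximum of it.\<close>

lemma maximal_point_exists:
  assumes cw: "closed_walk \<tau> n"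
  obtains x where "\<And>i j. cross3 (snd (\<tau> i)) (snd (\<tau> j)) \<noteq> 0 \<Longrightarrow> orient (snd (\<tau> i)) (snd (\<tau> j)) x \<noteq> 0"
    "\<And>P q. \<forall>\<^sub>F p in nhds q. P p \<Longrightarrow> \<exists>p. P p \<and> net_crossing \<tau> n x p \<le> 0"
proof -
  let ?v = "\<lambda>j. snd (\<tau> j)"
  have w: "walk \<tau>" using cw by (simp add: closed_walk_def)
  let ?X = "{(a, b). a \<in> range ?v \<and> b \<in> range ?v \<and> cross3 a b \<noteq> 0}"
  have "?X \<subseteq> range ?v \<times> range ?v" by auto
  then have finX: "finite ?X"
    by (rule finite_subset) (use walk_vertices_finite[OF w] in simp)
  have X: "cross3 a b \<noteq> 0" if "(a, b) \<in> ?X" for a b using that by simp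
  have True: "\<forall>\<^sub>F p in nhds (0::point). True" by simp
  obtain y where y: "\<And>j. orient (?v j) (?v (Suc j)) y \<noteq> 0"
    by (rule walk_generic_point[OF w True, of "{}" "{}"]) auto
  \<comment> \<open>Planes through y and a vertex are avoided so that x can later form a triangle
    with y.\<close>
  define G where "G p \<longleftrightarrow> (\<forall>j. orient (?v j) (?v (Suc j)) p \<noteq> 0) \<and> (\<forall>a b. (a, b) \<in> ?X \<longrightarrow> orient a b p \<noteq> 0) \<and>
      (\<forall>j. orient y (?v j) p \<noteq> 0)" for p
  obtain x0 where x0: "G x0"
  proof (rule walk_generic_point[OF w True finX X, of "{y}"])
    fix p assume "\<And>j. orient (?v j) (?v (Suc j)) p \<noteq> 0" "\<And>a b. (a, b) \<in> ?X \<Longrightarrow> orient a b p \<noteq> 0"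
      "\<And>z j. z \<in> {y} \<Longrightarrow> orient z (?v j) p \<noteq> 0"
    then have "G p" unfolding G_def by blast
    then show thesis by (rule that)
  qed (use y in auto)
  have bound: "\<bar>net_crossing \<tau> n y p\<bar> \<le> int n" for p
  proof -
    have "\<bar>net_crossing \<tau> n y p\<bar> \<le> (\<Sum>k<n. \<bar>crossing y p (?v k) (?v (Suc k))\<bar>)"
      unfolding net_crossing_def by (rule sum_abs)
    also have "\<dots> \<le> (\<Sum>k<n. 1)" by (intro sum_mono crossing_bounds)
    finally show ?thesis by simp
  qed
  \<comment> \<open>The shift by n turns the bounded integer potential into a natural number, so
    that a maximum exists.\<close>
  have "\<forall>p. G p \<longrightarrow> nat (net_crossing \<tau> n y p + int n) < Suc (2 * n)"
  proof (intro allI impI)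
    fix p show "nat (net_crossing \<tau> n y p + int n) < Suc (2 * n)"
      using bound[of p] by (simp add: abs_le_iff nat_le_iff less_Suc_eq_le)
  qed
  from ex_has_greatest_nat[of G, OF x0 this]
  obtain x where x: "G x" "\<And>p. G p \<Longrightarrow> nat (net_crossing \<tau> n y p + int n) \<le> nat (net_crossing \<tau> n y x + int n)"
    by blast
  have max: "net_crossing \<tau> n y p \<le> net_crossing \<tau> n y x" if "G p" for p
    using x(2)[OF that] bound[of p] bound[of x] by (simp add: abs_le_iff nat_le_eq_zle)
  have yx: "cross3 y x \<noteq> 0"
  proof
    assume "cross3 y x = 0"
    then have "orient y x (?v 0) = 0" by (simp add: orient_def)
    then show False using x(1) orient_swap(2)[of y x "?v 0"] by (simp add: G_def)
  qed
  have "\<exists>p. P p \<and> net_crossing \<tau> n x p \<le> 0" if P: "\<forall>\<^sub>F p in nhds q. P p" for P q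
  proof -
    have finX': "finite (insert (y, x) ?X)" using finX by simp
    obtain p where p: "P p" "\<And>j. orient (?v j) (?v (Suc j)) p \<noteq> 0"
      "\<And>a b. (a, b) \<in> insert (y, x) ?X \<Longrightarrow> orient a b p \<noteq> 0"
      "\<And>z j. z \<in> {x, y} \<Longrightarrow> orient z (?v j) p \<noteq> 0"
      by (rule walk_generic_point[OF w P finX', of "{x, y}"]) (use y x yx in \<open>auto simp: G_def\<close>)
    have "G p" using p by (auto simp: G_def)
    have "net_crossing \<tau> n y x + net_crossing \<tau> n x p + net_crossing \<tau> n p y = 0"
    proof (rule net_crossing_triangle[OF cw])
      show "orient y x p \<noteq> 0" using p(3) by simp
      show "orient y x (?v k) \<noteq> 0" for k
        using x(1) orient_swap(2)[of y x "?v k"] by (simp add: G_def)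
      show "orient x p (?v k) \<noteq> 0" for k using p(4)[of x k] orient_swap(2)[of x p "?v k"] by simp
      show "orient p y (?v k) \<noteq> 0" for k using p(4)[of y k] orient_cycle[of y "?v k" p] by simp
    qed (use y x(1) p(2) in \<open>auto simp: G_def\<close>)
    then have "net_crossing \<tau> n x p \<le> 0"
      using max[OF \<open>G p\<close>] net_crossing_commute[of \<tau> n p y] by simp
    with p(1) show ?thesis by blast
  qed
  moreover have "orient (?v i) (?v j) x \<noteq> 0" if "cross3 (?v i) (?v j) \<noteq> 0" for i j
    using x(1) that by (auto simp: G_def)
  ultimately show ?thesis using that[of x] by blast
qed

end

section \<open>Pieces of a right-turning cycle\<close>

locale right_cycle = diagram +
  fixes \<tau> :: "nat \<Rightarrow> arc \<times> point" and n :: nat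
  assumes closed: "closed_walk \<tau> n" and turn: "\<And>i. \<tau> (Suc i) = right_turn (\<tau> i)"
begin

abbreviation v :: "nat \<Rightarrow> point" where "v i \<equiv> snd (\<tau> i)"

text \<open>Piece i leads from \<open>v i\<close> to \<open>v (Suc i)\<close>, so its arc is that of
  state \<open>Suc i\<close>.\<close>

definition piece_arc :: "nat \<Rightarrow> arc" where "piece_arc i = fst (\<tau> (Suc i))"

definition piece :: "nat \<Rightarrow> point set" where
  "piece i = {\<gamma> *\<^sub>R v i + \<delta> *\<^sub>R v (Suc i) | \<gamma> \<delta>. \<gamma> \<ge> 0 \<and> \<delta> \<ge> 0}"

lemma walk: "walk \<tau>" and n_pos: "n > 0"
  using closed by (auto simp: closed_walk_def)

lemma state: "\<tau> i \<in> states"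
  using walk by (simp add: walk_def)

lemma piece_arc: "piece_arc i \<in> D" "is_arc (piece_arc i)" "v i \<in> arc_cone (piece_arc i)"
    "v (Suc i) \<in> endpoints (piece_arc i)"
  using walkD[OF walk] by (auto simp: piece_arc_def)

lemma v_norm: "norm (v i) = 1"
  using walkD[OF walk] by simp

lemma v_piece_independent: "cross3 (v i) (v (Suc i)) \<noteq> 0"
  by (rule walk_piece_nonzero[OF walk])

lemma right_turns: "orient (v i) (v (Suc i)) (v (Suc (Suc i))) < 0"
proof -
  obtain k where "k > 0" "\<And>X. orient (v i) (v (Suc i)) X = k * orient (source (\<tau> (Suc i))) (v (Suc i)) X"
    using source_direction[OF state, of "v i" "Suc i"] piece_arc(3)[of i] by (auto simp: piece_arc_def)
  then show ?thesis
    using right_turn(3)[OF state[of "Suc i"]] turn[of "Suc i"] by (simp add: mult_pos_neg)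
qed

text \<open>On a periodic orbit \<open>right_turn\<close> is inverted by going on for n - 1 further
  steps.\<close>

lemma predecessor_unique:
  assumes "\<tau> (Suc i) = \<tau> (Suc j)"
  shows "\<tau> i = \<tau> j"
proof -
  have "\<tau> (Suc i + m) = \<tau> (Suc j + m)" for m
    by (induction m) (use assms turn in auto)
  from this[of "n - 1"] have "\<tau> (i + n) = \<tau> (j + n)" using n_pos by simp
  then show ?thesis using closed by (simp add: closed_walk_def)
qed

lemma reduce_index: "\<tau> (k mod n) = \<tau> k" "\<tau> (Suc (k mod n)) = \<tau> (Suc k)"
  using closed_walk_shift[OF closed, of "k mod n" "k div n"] closed_walk_shift[OF closed, of "Suc (k mod n)" "k div n"]
  by simp_all

lemma predecessor_index:
  obtains k where "k < n" "\<tau> (Suc k) = \<tau> j"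
proof -
  have "\<tau> (Suc ((j + n - 1) mod n)) = \<tau> (j + n)" using reduce_index(2)[of "j + n - 1"] n_pos by simp
  then show ?thesis using that[of "(j + n - 1) mod n"] n_pos closed by (simp add: closed_walk_def)
qed

text \<open>In a cycle of right turns, the right side of a piece is hit only at its start, by its predecessor.\<close>

lemma hit_from_right:
  assumes "v (Suc k) \<in> arc_cone (piece_arc i)" "orient (v i) (v (Suc i)) (v k) < 0"
  shows "\<tau> (Suc k) = \<tau> i"
proof -
  obtain l where l: "l > 0" "\<And>X. orient (v (Suc k)) (v (Suc i)) X = l * orient (v i) (v (Suc i)) X"
    using orient_same_direction[OF assms(1) piece_arc(3,4)] by blast
  obtain m where m: "m > 0" "\<And>X. orient (v k) (v (Suc k)) X = m * orient (source (\<tau> (Suc k))) (v (Suc k)) X"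
    using source_direction[OF state, of "v k" "Suc k"] piece_arc(3)[of k] by (auto simp: piece_arc_def)
  have "orient (v k) (v (Suc k)) (v (Suc i)) = orient (v (Suc k)) (v (Suc i)) (v k)"
    by (simp add: orient_cycle[of "v (Suc k)"])
  also have "\<dots> < 0" using l assms(2) by (simp add: mult_pos_neg)
  finally have "orient (source (\<tau> (Suc k))) (v (Suc k)) (v (Suc i)) < 0"
    using m by (simp add: mult_less_0_iff)
  then have "right_turn (\<tau> (Suc k)) = (piece_arc i, v (Suc i))"
    by (intro right_turn_unique state piece_arc assms(1))
  then have "\<tau> (Suc (Suc k)) = \<tau> (Suc i)" using turn by (simp add: piece_arc_def)
  then show ?thesis by (rule predecessor_unique)
qed

lemma pieceI: "\<gamma> \<ge> 0 \<Longrightarrow> \<delta> \<ge> 0 \<Longrightarrow> \<gamma> *\<^sub>R v i + \<delta> *\<^sub>R v (Suc i) \<in> piece i"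
  by (auto simp: piece_def)

lemma vertex_in_piece: "v i \<in> piece i" "v (Suc i) \<in> piece i"
  using pieceI[of 1 0 i] pieceI[of 0 1 i] by simp_all

lemma piece_combination:
  assumes "p \<in> piece i" "q \<in> piece i" "\<alpha> \<ge> 0" "\<beta> \<ge> 0"
  shows "\<alpha> *\<^sub>R p + \<beta> *\<^sub>R q \<in> piece i"
proof -
  obtain a b c d where "a \<ge> 0" "b \<ge> 0" "c \<ge> 0" "d \<ge> 0"
    "p = a *\<^sub>R v i + b *\<^sub>R v (Suc i)" "q = c *\<^sub>R v i + d *\<^sub>R v (Suc i)"
    using assms(1,2) by (auto simp: piece_def)
  then show ?thesis
    using pieceI[of "\<alpha> * a + \<beta> * c" "\<alpha> * b + \<beta> * d" i] assms(3,4) by (simp add: algebra_simps)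
qed

lemma piece_scale: "p \<in> piece i \<Longrightarrow> \<alpha> \<ge> 0 \<Longrightarrow> \<alpha> *\<^sub>R p \<in> piece i"
  using piece_combination[of p i p \<alpha> 0] by simp

text \<open>The start of a piece is already interior to its arc, so only its end can lie inside a
  different arc.\<close>

lemma piece_meets_cone:
  assumes "p \<in> piece k" "p \<in> arc_cone a" "a \<in> D"
  shows "piece_arc k = a \<or> (\<exists>\<delta>>0. p = \<delta> *\<^sub>R v (Suc k)) \<and> v (Suc k) \<in> arc_cone a"
proof -
  obtain \<gamma> \<delta> where c: "\<gamma> \<ge> 0" "\<delta> \<ge> 0" "p = \<gamma> *\<^sub>R v k + \<delta> *\<^sub>R v (Suc k)"
    using assms(1) by (auto simp: piece_def)
  show ?thesis
  proof (cases "\<gamma> = 0")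
    case False
    then have "p \<in> arc_cone (piece_arc k)"
      unfolding c(3) using c piece_arc by (intro arc_cone_combination) auto
    then show ?thesis using arc_cones_disjoint[OF piece_arc(1) assms(3)] assms(2) by blast
  next
    case True
    have "p \<noteq> 0"
      using assms(2) cross3_nonzero_imp_independent(1)[OF arc_cross3_nonzero[OF is_arc_D[OF assms(3)]]]
      by (force simp: arc_cone_def)
    then have "\<delta> > 0" using c True by (cases "\<delta> = 0") auto
    moreover have "inverse \<delta> *\<^sub>R p + 0 *\<^sub>R fst a \<in> arc_cone a"
      using assms(2) \<open>\<delta> > 0\<close> by (intro arc_cone_combination) (auto simp: endpoints_def)
    moreover have "inverse \<delta> *\<^sub>R p + 0 *\<^sub>R fst a = v (Suc k)" using c True \<open>\<delta> > 0\<close> by simp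
    moreover have "p = \<delta> *\<^sub>R v (Suc k)" using c True by simp
    ultimately show ?thesis by metis
  qed
qed

lemma piece_coplanar:
  assumes "p \<in> piece k" "piece_arc k = piece_arc i"
  shows "orient (v i) (v (Suc i)) p = 0"
proof -
  obtain m where m: "\<And>X. orient (v i) (v (Suc i)) X = m * orient (v k) (v (Suc k)) X"
    using orient_same_arc[OF piece_arc(2)[of i] piece_arc(3)[of i] _ piece_arc(4)[of i], of "v k" "v (Suc k)"]
      piece_arc(3,4)[of k] assms(2) by metis
  show ?thesis using assms(1) unfolding m by (auto simp: piece_def)
qed

end

section \<open>The view from a point of maximal potential\<close>

locale maximal_point = right_cycle +
  fixes x :: point
  assumes generic: "\<And>i j. cross3 (v i) (v j) \<noteq> 0 \<Longrightarrow> orient (v i) (v j) x \<noteq> 0"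
    and maximal: "\<And>P q. \<forall>\<^sub>F p in nhds q. P p \<Longrightarrow> \<exists>p. P p \<and> net_crossing \<tau> n x p \<le> 0"
begin

text \<open>Nothing blocks the segment from x before w is reached; w itself may lie on the
  cycle.\<close>

definition visible :: "point \<Rightarrow> bool" where
  "visible w \<longleftrightarrow> (\<forall>k \<alpha> \<beta>. \<alpha> > 0 \<longrightarrow> \<beta> \<ge> 0 \<longrightarrow> \<alpha> *\<^sub>R x + \<beta> *\<^sub>R w \<notin> piece k)"

definition right_of :: "nat \<Rightarrow> bool" where
  "right_of i \<longleftrightarrow> orient (v i) (v (Suc i)) x < 0"

lemma generic_piece: "orient (v i) (v (Suc i)) x \<noteq> 0"
  using generic v_piece_independent by blast

lemma not_right_of: "\<not> right_of i \<longleftrightarrow> orient (v i) (v (Suc i)) x > 0"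
  using generic_piece[of i] by (auto simp: right_of_def)

lemma x_notin_piece: "\<alpha> \<noteq> 0 \<Longrightarrow> \<alpha> *\<^sub>R x \<notin> piece k"
  using generic_piece[of k] piece_coplanar[of "\<alpha> *\<^sub>R x" k k] by auto

lemma generic_parallel:
  assumes "orient x (v i) (v j) = 0"
  shows "v i = v j \<or> v i = - v j"
  using assms generic[of i j] cross3_eq_0_unit[of "v i" "v j"] v_norm by (auto simp: orient_cycle)

text \<open>Looking past a left side with nothing counted negatively would lead to a potential above
  the maximum.\<close>

lemma no_left_crossing:
  assumes "\<And>k. k < n \<Longrightarrow> \<forall>\<^sub>F \<epsilon> in at_right 0. \<forall>\<^sub>F p in nhds (e + \<epsilon> *\<^sub>R z). crossing x p (v k) (v (Suc k)) \<ge> 0"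
    and "j < n" "\<forall>\<^sub>F \<epsilon> in at_right 0. \<forall>\<^sub>F p in nhds (e + \<epsilon> *\<^sub>R z). crossing x p (v j) (v (Suc j)) = 1"
  shows False
proof -
  have "\<forall>\<^sub>F \<epsilon> in at_right 0. \<forall>k\<in>{..<n}. \<forall>\<^sub>F p in nhds (e + \<epsilon> *\<^sub>R z). crossing x p (v k) (v (Suc k)) \<ge> 0"
    using assms(1) by (intro eventually_ball_finite) auto
  with assms(3) have "\<forall>\<^sub>F \<epsilon> in at_right 0. \<forall>\<^sub>F p in nhds (e + \<epsilon> *\<^sub>R z). net_crossing \<tau> n x p \<ge> 1"
  proof eventually_elim
    case (elim \<epsilon>)
    have "\<forall>\<^sub>F p in nhds (e + \<epsilon> *\<^sub>R z). \<forall>k\<in>{..<n}. crossing x p (v k) (v (Suc k)) \<ge> 0"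
      using elim(2) by (intro eventually_ball_finite) auto
    with elim(1) show ?case
    proof eventually_elim
      case (elim p)
      have "crossing x p (v j) (v (Suc j)) \<le> net_crossing \<tau> n x p"
        unfolding net_crossing_def by (rule member_le_sum) (use elim assms(2) in auto)
      with elim(1) show ?case by simp
    qed
  qed
  then obtain \<epsilon> where "\<forall>\<^sub>F p in nhds (e + \<epsilon> *\<^sub>R z). net_crossing \<tau> n x p \<ge> 1"
    using eventually_happens trivial_limit_at_right_real by blast
  from maximal[OF this] show False by auto
qed

text \<open>A piece that meets neither the line of sight from x to e nor e itself is strictly
  separated from it.\<close>

lemma crossing_nonneg_near:
  assumes "\<And>\<alpha> \<beta>. \<alpha> > 0 \<Longrightarrow> \<beta> > 0 \<Longrightarrow> \<alpha> *\<^sub>R x + \<beta> *\<^sub>R e \<notin> piece k" "e \<notin> piece k"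
  shows "\<forall>\<^sub>F \<epsilon> in at_right 0. \<forall>\<^sub>F p in nhds (e + \<epsilon> *\<^sub>R z). crossing x p (v k) (v (Suc k)) \<ge> 0"
proof -
  have "\<forall>\<^sub>F R in nhds x. \<forall>\<^sub>F p in nhds e. crossing R p (v k) (v (Suc k)) = 0"
  proof (rule crossing_eventually_0)
    fix \<alpha> \<beta> \<gamma> \<delta> :: real
    assume nn: "\<alpha> \<ge> 0" "\<beta> \<ge> 0" "\<gamma> \<ge> 0" "\<delta> \<ge> 0" and eq: "\<alpha> *\<^sub>R x + \<beta> *\<^sub>R e = \<gamma> *\<^sub>R v k + \<delta> *\<^sub>R v (Suc k)"
    have mem: "\<alpha> *\<^sub>R x + \<beta> *\<^sub>R e \<in> piece k" unfolding eq using nn by (intro pieceI)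
    have "\<alpha> = 0"
    proof (rule ccontr)
      assume "\<alpha> \<noteq> 0"
      then show False
        using assms(1)[of \<alpha> \<beta>] mem nn x_notin_piece[of \<alpha> k] by (cases "\<beta> = 0") auto
    qed
    moreover have "\<beta> = 0"
    proof (rule ccontr)
      assume "\<beta> \<noteq> 0"
      then have "e = inverse \<beta> *\<^sub>R (\<alpha> *\<^sub>R x + \<beta> *\<^sub>R e)" using \<open>\<alpha> = 0\<close> by simp
      also have "\<dots> \<in> piece k" by (rule piece_scale[OF mem]) (use nn in simp)
      finally show False using assms(2) by simp
    qed
    ultimately have "\<gamma> *\<^sub>R v k + \<delta> *\<^sub>R v (Suc k) = 0" using eq by simp
    then show "\<alpha> = 0 \<and> \<beta> = 0 \<and> \<gamma> = 0 \<and> \<delta> = 0"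
      using \<open>\<alpha> = 0\<close> \<open>\<beta> = 0\<close> cross3_nonzero_imp_independent[OF v_piece_independent] by blast
  qed
  then have "\<forall>\<^sub>F p in nhds e. crossing x p (v k) (v (Suc k)) = 0"
    by (rule eventually_nhds_x_imp_x)
  then have "\<forall>\<^sub>F p in nhds e. crossing x p (v k) (v (Suc k)) \<ge> 0"
    by eventually_elim simp
  then show ?thesis by (rule eventually_nhds_along_ray)
qed

text \<open>At a visible vertex where the walk turns back from going counterclockwise around \<open>x\<close> to going
  clockwise, the point \<open>x\<close> would see the left side of the incoming piece.\<close>

lemma no_visible_fold:
  assumes "j < n" "\<not> right_of j" "right_of (Suc j)"
    and vis: "\<And>k \<alpha> \<beta>. \<alpha> > 0 \<Longrightarrow> \<beta> > 0 \<Longrightarrow> \<alpha> *\<^sub>R x + \<beta> *\<^sub>R v (Suc j) \<notin> piece k"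
  shows False
proof -
  let ?u = "v j" and ?e = "v (Suc j)" and ?t = "v (Suc (Suc j))"
  \<comment> \<open>This direction leads into the fold, to the right of both pieces, and beyond the
    incoming one as seen from x. The vertex ?e then lies to the left of the line of sight, so pieces
    ending there cannot count -1.\<close>
  let ?z = "?u + ?t"
  have L: "orient ?u ?e x > 0" and R: "orient ?e ?t x < 0"
    using assms(2,3) by (simp_all add: not_right_of, simp add: right_of_def)
  have 1: "orient x ?z ?e > 0"
    using L R orient_cycle[of ?u ?e x] orient_swap(2)[of x ?t ?e] orient_cycle[of ?e ?t x] by simp
  have pos: "\<forall>\<^sub>F \<epsilon> in at_right (0::real). \<epsilon> > 0" by (rule eventually_at_right_less)
  have side: "\<forall>\<^sub>F \<epsilon> in at_right 0. \<forall>\<^sub>F p in nhds (?e + \<epsilon> *\<^sub>R ?z). orient x p ?e > 0"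
    using pos
  proof eventually_elim
    case (elim \<epsilon>)
    have "orient x (?e + \<epsilon> *\<^sub>R ?z) ?e = \<epsilon> * orient x ?z ?e" by simp
    then show ?case
      using elim 1 by (intro eventually_nhds_pos continuous_intros) (simp only: zero_less_mult_iff, blast)
  qed
  have below: "\<forall>\<^sub>F \<epsilon> in at_right 0. \<forall>\<^sub>F p in nhds (?e + \<epsilon> *\<^sub>R ?z). orient ?e ?t p < 0"
    using pos
  proof eventually_elim
    case (elim \<epsilon>)
    have "orient ?e ?t (?e + \<epsilon> *\<^sub>R ?z) = \<epsilon> * orient ?u ?e ?t" by (simp add: orient_cycle[of ?e ?t ?u])
    then show ?case
      using elim right_turns[of j] by (intro eventually_nhds_neg continuous_intros) (simp only: mult_less_0_iff, blast)
  qed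
  have behind: "\<forall>\<^sub>F \<epsilon> in at_right 0. \<forall>\<^sub>F p in nhds (?e + \<epsilon> *\<^sub>R ?z). orient ?u ?e p < 0"
    using pos
  proof eventually_elim
    case (elim \<epsilon>)
    have "orient ?u ?e (?e + \<epsilon> *\<^sub>R ?z) = \<epsilon> * orient ?u ?e ?t" by simp
    then show ?case
      using elim right_turns[of j] by (intro eventually_nhds_neg continuous_intros) (simp only: mult_less_0_iff, blast)
  qed
  show False
  proof (rule no_left_crossing[OF _ assms(1)])
    have "orient x ?e ?u < 0" using L orient_swap(3)[of x ?e ?u] by simp
    then have "\<forall>\<^sub>F \<epsilon> in at_right 0. \<forall>\<^sub>F p in nhds (?e + \<epsilon> *\<^sub>R ?z). orient x p ?u < 0"
      by (intro eventually_nhds_along_ray eventually_nhds_neg continuous_intros)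
    with side behind show "\<forall>\<^sub>F \<epsilon> in at_right 0. \<forall>\<^sub>F p in nhds (?e + \<epsilon> *\<^sub>R ?z). crossing x p ?u ?e = 1"
    proof eventually_elim
      case (elim \<epsilon>)
      then show ?case by eventually_elim (use L in \<open>simp add: crossing_def\<close>)
    qed
  next
    fix k assume "k < n"
    consider "v (Suc k) = ?e" | "piece_arc k = piece_arc (Suc j)" | "v (Suc k) \<noteq> ?e" "piece_arc k \<noteq> piece_arc (Suc j)"
      by blast
    then show "\<forall>\<^sub>F \<epsilon> in at_right 0. \<forall>\<^sub>F p in nhds (?e + \<epsilon> *\<^sub>R ?z). crossing x p (v k) (v (Suc k)) \<ge> 0"
    proof cases
      case 1
      from side show ?thesis
        by eventually_elim (erule eventually_mono, use 1 in \<open>auto intro!: crossing_nonneg simp: less_imp_le\<close>)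
    next
      case 2
      then obtain l where l: "l \<noteq> 0" "\<And>X. orient (v k) (v (Suc k)) X = l * orient ?e ?t X"
        using orient_same_arc[OF piece_arc(2)[of k] piece_arc(3)[of k] _ piece_arc(4)[of k], of ?e ?t]
          piece_arc(3,4)[of "Suc j"] by metis
      from below show ?thesis
      proof eventually_elim
        case (elim \<epsilon>)
        then show ?case
        proof eventually_elim
          case (elim p)
          show ?case
          proof (cases "l > 0")
            case True
            then have "l * orient ?e ?t p < 0" using elim by (simp add: mult_pos_neg)
            then show ?thesis by (intro crossing_nonneg) (simp add: l)
          next
            case False
            then have "l * orient ?e ?t x > 0" using R l(1) by (simp add: mult_neg_neg)
            then show ?thesis by (intro crossing_nonneg) (simp add: l)
          qed
        qed
      qed
    next
      case 3
      show ?thesis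
      proof (rule crossing_nonneg_near[OF vis])
        show "?e \<notin> piece k"
        proof
          assume "?e \<in> piece k"
          from piece_meets_cone[OF this piece_arc(3)[of "Suc j"] piece_arc(1)] 3(2)
          obtain d where "d > 0" "?e = d *\<^sub>R v (Suc k)" by blast
          then show False using 3(1) v_norm[of "Suc j"] v_norm[of "Suc k"] by simp
        qed
      qed
    qed
  qed
qed

end

context maximal_point
begin

text \<open>Suppose a piece hides a point between A and the end t. Followed towards the ray xA, it
  can leave the triangle x, A, t neither across the visible side xA nor through the arc At, so it
  has a vertex inside. Among the vertices inside, the one nearest to the ray xA in angle is a
  visible fold. The hypothesis \<open>prev\<close> deals with A at the start of the piece, where the
  predecessor arrives.\<close>

lemma visible_along_piece:
  assumes right: "right_of (Suc i)"
    and A: "A = \<gamma> *\<^sub>R v (Suc i) + \<delta> *\<^sub>R v (Suc (Suc i))" "\<gamma> > 0" "\<delta> \<ge> 0"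
    and visA: "visible A" and prev: "\<delta> > 0 \<or> right_of i"
    and nonneg: "\<gamma>' \<ge> 0" "\<delta>' \<ge> 0"
  shows "visible (\<gamma>' *\<^sub>R A + \<delta>' *\<^sub>R v (Suc (Suc i)))"
proof -
  let ?u = "v (Suc i)" and ?t = "v (Suc (Suc i))"
  \<comment> \<open>Coordinates with respect to \<open>x\<close>, \<open>A\<close>, \<open>t\<close>, scaled by the positive number \<open>d\<close>.\<close>
  define d where "d = - orient x A ?t"
  define a where "a X = - orient X A ?t" for X
  define b where "b X = - orient x X ?t" for X
  define g where "g X = - orient x A X" for X
  have plane: "orient A ?t X = \<gamma> * orient ?u ?t X" for X unfolding A(1) by simp
  have d: "d > 0"
    using right A(2) plane[of x] orient_cycle[of A ?t x]
    unfolding right_of_def d_def by (simp add: mult_pos_neg)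
  have cramer: "d *\<^sub>R X = a X *\<^sub>R x + b X *\<^sub>R A + g X *\<^sub>R ?t" for X
    using arg_cong[OF orient_cramer[of x A ?t X], of uminus] unfolding d_def a_def b_def g_def by simp
  have lin [simp]: "a (p *\<^sub>R X + q *\<^sub>R Y) = p * a X + q * a Y" "b (p *\<^sub>R X + q *\<^sub>R Y) = p * b X + q * b Y"
      "g (p *\<^sub>R X + q *\<^sub>R Y) = p * g X + q * g Y" for p q X Y
    unfolding a_def b_def g_def by simp_all
  \<comment> \<open>For points of the triangle, a positive value means that Y is closer in angle
    than r to the ray xA.\<close>
  have low: "d * orient x r Y = g r * b Y - b r * g Y" for r Y
  proof -
    have "d * orient x r Y = orient x r (d *\<^sub>R Y)" by simp
    also have "\<dots> = b Y * orient x r A + g Y * orient x r ?t" unfolding cramer by simp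
    also have "\<dots> = g r * b Y - b r * g Y"
      unfolding g_def[of r] b_def[of r] using orient_swap(2)[of x A r] by simp
    finally show ?thesis .
  qed
  have A_cone: "A \<in> arc_cone (piece_arc (Suc i))"
    unfolding A(1) using A(2,3) piece_arc[of "Suc i"] by (intro arc_cone_combination) auto
  \<comment> \<open>A piece cannot leave the region below the arc from \<open>A\<close> to \<open>t\<close> through that arc.\<close>
  have no_exit: False
    if H: "X \<in> piece k" "r \<in> piece k" "a X = 0" "b X > 0" "g X \<ge> 0" "a r > 0" "g r > 0" for X r k
  proof -
    have X: "d *\<^sub>R X = b X *\<^sub>R A + g X *\<^sub>R ?t" using cramer[of X] H(3) by simp
    also have "\<dots> \<in> arc_cone (piece_arc (Suc i))"
      using A_cone that piece_arc[of "Suc i"] by (intro arc_cone_combination) auto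
    finally have "d *\<^sub>R X \<in> arc_cone (piece_arc (Suc i))" .
    moreover have "d *\<^sub>R X \<in> piece k" using H(1) d by (intro piece_scale) auto
    moreover have ne: "piece_arc k \<noteq> piece_arc (Suc i)"
    proof
      assume "piece_arc k = piece_arc (Suc i)"
      then have "orient ?u ?t r = 0" using piece_coplanar H(2) by blast
      then have "a r = 0" using plane[of r] by (simp add: a_def orient_cycle[of A])
      then show False using H(6) by simp
    qed
    ultimately obtain e where e: "e > 0" "d *\<^sub>R X = e *\<^sub>R v (Suc k)" "v (Suc k) \<in> arc_cone (piece_arc (Suc i))"
      using piece_meets_cone[OF _ _ piece_arc(1)] by blast
    obtain l m where r: "l \<ge> 0" "m \<ge> 0" "r = l *\<^sub>R v k + m *\<^sub>R v (Suc k)"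
      using H(2) by (auto simp: piece_def)
    have "orient A ?t (v (Suc k)) = 0"
      using orient_arc[OF A_cone piece_arc(4)] orient_arc_cone_0[OF e(3)] by (metis mult_zero_right)
    then have "orient A ?t r = l * orient A ?t (v k)" using r by simp
    moreover have "orient A ?t r < 0" using H(6) unfolding a_def by (simp add: orient_cycle[of A])
    ultimately have l: "l > 0" "orient A ?t (v k) < 0"
      using r(1) by (auto simp: mult_less_0_iff)
    then have "orient ?u ?t (v k) < 0" using plane[of "v k"] A(2) by (simp add: mult_less_0_iff)
    \<comment> \<open>Piece k reaches the arc from its right and is thus the predecessor, ending at
      ?u. Then A is a multiple of ?u, and \<open>prev\<close> puts the predecessor beyond the ray
      xA.\<close>
    then have hit: "\<tau> (Suc k) = \<tau> (Suc i)" using hit_from_right[OF e(3)] by blast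
    have "(b X * \<gamma> - e) *\<^sub>R ?u + (b X * \<delta> + g X) *\<^sub>R ?t = 0"
      using X e(2) unfolding hit A(1) by (simp add: algebra_simps)
    then have "b X * \<delta> + g X = 0"
      using cross3_nonzero_imp_independent(2)[OF v_piece_independent] by blast
    moreover have "b X * \<delta> \<ge> 0" using H(4) A(3) by simp
    ultimately have "b X * \<delta> = 0" using H(5) by linarith
    then have "\<delta> = 0" using H(4) by simp
    then have "orient (v i) ?u x < 0" using prev by (simp add: right_of_def)
    moreover have "v k = v i" using predecessor_unique[OF hit] by simp
    moreover have "g r = - (\<gamma> * l * orient x ?u (v k))"
      unfolding g_def r(3) A(1) \<open>\<delta> = 0\<close> using hit by simp
    then have "\<gamma> * l * orient x ?u (v k) < 0" using H(7) by simp
    then have "orient x ?u (v k) < 0" using A(2) l(1) by (simp add: mult_less_0_iff)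
    ultimately show False using orient_swap(3)[of x ?u "v i"] by simp
  qed
  have below: "b (v j) > 0" if "a (v j) > 0" "b (v j) \<ge> 0" for j
  proof (rule ccontr)
    assume "\<not> b (v j) > 0"
    then have "orient x (v j) ?t = 0" using that by (simp add: b_def)
    then have "v j = ?t \<or> v j = - ?t" by (rule generic_parallel)
    then show False using that(1) by (auto simp: a_def)
  qed
  let ?T = "\<lambda>X. a X > 0 \<and> b X > 0 \<and> g X > 0"
  have lower_vertex: "\<exists>j. ?T (v j) \<and> (orient x r (v j) > 0 \<or> (\<exists>s>0. r = s *\<^sub>R v j))"
    if r: "r \<in> piece k" "a r > 0" "b r \<ge> 0" "g r > 0" for r k
  proof -
    obtain l m where lm: "l \<ge> 0" "m \<ge> 0" "r = l *\<^sub>R v k + m *\<^sub>R v (Suc k)"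
      using r(1) by (auto simp: piece_def)
    show ?thesis
    proof (cases "l = 0 \<or> m = 0")
      case True
      then have "r = m *\<^sub>R v (Suc k) \<or> r = l *\<^sub>R v k" using lm(3) by auto
      then obtain j s where js: "s \<ge> 0" "r = s *\<^sub>R v j" using lm(1,2) by blast
      then have "s \<noteq> 0" using r(2) by (auto simp: a_def)
      then have s: "s > 0" using js by simp
      have "a r = s * a (v j)" "b r = s * b (v j)" "g r = s * g (v j)"
        unfolding js(2) a_def b_def g_def by simp_all
      then have "a (v j) > 0" "b (v j) \<ge> 0" "g (v j) > 0"
        using r s by (auto simp: zero_less_mult_iff zero_le_mult_iff)
      then show ?thesis using below s js(2) by blast
    next
      case False
      then have l: "l > 0" "m > 0" using lm by auto
      have "orient x r (v k) = - m * orient x (v k) (v (Suc k))"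
        unfolding lm(3) using orient_swap(2)[of x "v k" "v (Suc k)"] by simp
      moreover have "orient x r (v (Suc k)) = l * orient x (v k) (v (Suc k))"
        unfolding lm(3) by simp
      moreover have "orient x (v k) (v (Suc k)) \<noteq> 0"
        using generic_piece[of k] orient_cycle[of "v k" "v (Suc k)" x] by simp
      ultimately have "orient x r (v k) > 0 \<or> orient x r (v (Suc k)) > 0"
        using l by (auto simp: zero_less_mult_iff mult_less_0_iff)
      \<comment> \<open>This is the end of the piece towards which the angle to the ray xA
        decreases.\<close>
      then obtain j where j: "orient x r (v j) > 0" "v j \<in> piece k"
        using vertex_in_piece[of k] by blast
      let ?L = "v j"
      have down: "b X > 0" if "X = p *\<^sub>R r + q *\<^sub>R ?L" "q > 0" "g X \<ge> 0" for X p q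
      proof -
        have "orient x r X = q * orient x r ?L" using that(1) by simp
        then have "d * orient x r X > 0" using that(2) j(1) d by simp
        then have "g r * b X > b r * g X" using low[of r X] by simp
        moreover have "b r * g X \<ge> 0" using r(3) that(3) by simp
        ultimately have "g r * b X > 0" by linarith
        then show ?thesis using r(4) by (simp add: zero_less_mult_iff)
      qed
      have bL: "b ?L > 0" if "g ?L \<ge> 0" using down[of ?L 0 1] that by simp
      show ?thesis
      proof (cases "a ?L > 0 \<and> g ?L > 0")
        case True
        then show ?thesis using bL j(1) by (intro exI[of _ j]) auto
      next
        case False
        \<comment> \<open>Up to scaling, these are the points where the line through r and ?L meets
          the planes of x, A and of A, t: the coefficients cancel g and a. If ?L is outside the
          triangle, X contradicts the visibility of A or \<open>no_exit\<close>, or Y contradicts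
          \<open>no_exit\<close>.\<close>
        define X Y where XY: "X = (- g ?L) *\<^sub>R r + g r *\<^sub>R ?L" "Y = (- a ?L) *\<^sub>R r + a r *\<^sub>R ?L"
        have gX: "g X = 0" and aX: "a X = g r * a ?L - g ?L * a r"
          and aY: "a Y = 0" and gY: "g Y = a r * g ?L - a ?L * g r" unfolding XY lin by simp_all
        show ?thesis
        proof (cases "g ?L \<le> 0 \<and> a X \<ge> 0")
          case True
          then have memX: "X \<in> piece k" unfolding XY using r j by (intro piece_combination) auto
          have bX: "b X > 0" using down[OF XY(1) r(4)] gX by simp
          have "a X = 0"
          proof (rule ccontr)
            assume "a X \<noteq> 0"
            then have "a X > 0" using True by simp
            then have "a X *\<^sub>R x + b X *\<^sub>R A \<notin> piece k"
              using visA bX unfolding visible_def by (metis less_imp_le)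
            moreover have "d *\<^sub>R X \<in> piece k" using memX d by (intro piece_scale) auto
            ultimately show False unfolding cramer[of X] gX by simp
          qed
          then show ?thesis using no_exit[OF memX r(1)] bX gX r by simp
        next
          case notX: False
          have "a ?L \<le> 0 \<and> g Y > 0"
          proof (cases "g ?L \<le> 0")
            case True
            then have neg: "g r * a ?L - g ?L * a r < 0" using notX aX by simp
            moreover have "- g ?L * a r \<ge> 0" using True r(2) by (simp add: mult_nonpos_nonneg)
            ultimately have "g r * a ?L < 0" by simp
            then show ?thesis using r(4) neg gY by (auto simp: mult_less_0_iff algebra_simps)
          next
            case gpos: False
            then have "a ?L \<le> 0" using False by simp
            moreover have "a r * g ?L > 0" using r(2) gpos by simp
            moreover have "- a ?L * g r \<ge> 0" using \<open>a ?L \<le> 0\<close> r(4) by (simp add: mult_nonpos_nonneg)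
            ultimately show ?thesis using gY by simp
          qed
          then have Y: "a ?L \<le> 0" "g Y > 0" by auto
          then have "Y \<in> piece k" unfolding XY(2) using r j by (intro piece_combination) auto
          moreover have "b Y > 0" using down[OF XY(2) r(2)] Y by simp
          ultimately show ?thesis using no_exit[of Y k r] aY Y r by simp
        qed
      qed
    qed
  qed
  have empty: "\<not> ?T (v j)" for j
  proof
    assume "?T (v j)"
    \<comment> \<open>Vertices are listed as ends of pieces with index below n, as
      \<open>no_visible_fold\<close> requires.\<close>
    define J where "J = {k. k < n \<and> ?T (v (Suc k))}"
    have ex_J: "\<exists>k\<in>J. v (Suc k) = v j" if "?T (v j)" for j
    proof -
      obtain k where "k < n" "\<tau> (Suc k) = \<tau> j" by (rule predecessor_index)
      then show ?thesis using that by (auto simp: J_def)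
    qed
    have "finite J" by (simp add: J_def)
    moreover have "J \<noteq> {}" using ex_J[OF \<open>?T (v j)\<close>] by blast
    ultimately have J: "finite J" "J \<noteq> {}" .
    \<comment> \<open>The quotient of g by b grows with the angle at x measured from the ray to
      A.\<close>
    define k where "k = arg_min_on (\<lambda>l. g (v (Suc l)) / b (v (Suc l))) J"
    have k: "k \<in> J" "\<And>l. l \<in> J \<Longrightarrow> g (v (Suc k)) / b (v (Suc k)) \<le> g (v (Suc l)) / b (v (Suc l))"
      unfolding k_def by (rule arg_min_if_finite(1)[OF J], rule arg_min_least[OF J])
    let ?e = "v (Suc k)"
    have e: "a ?e > 0" "b ?e > 0" "g ?e > 0" "k < n" using k(1) by (auto simp: J_def)
    have least: "g ?e * b (v j) \<le> g (v j) * b ?e" if T: "?T (v j)" for j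
    proof -
      obtain l where l: "l \<in> J" "v (Suc l) = v j" using ex_J[OF T] by blast
      have "g ?e / b ?e \<le> g (v j) / b (v j)" using k(2)[OF l(1)] unfolding l(2) .
      then show ?thesis using e(2) T by (simp add: divide_le_eq le_divide_eq mult.commute)
    qed
    have lowest: "\<not> orient x ?e r > 0 \<and> (orient x ?e r = 0 \<longrightarrow> (\<exists>s>0. r = s *\<^sub>R ?e))"
      if r: "r \<in> piece l" "a r > 0" "b r \<ge> 0" "g r > 0" for r l
    proof -
      obtain j where j: "?T (v j)" "orient x r (v j) > 0 \<or> (\<exists>s>0. r = s *\<^sub>R v j)"
        using lower_vertex[OF r] by blast
      from j(2) show ?thesis
      proof
        assume "orient x r (v j) > 0"
        then have 1: "b r * g (v j) < g r * b (v j)" using low[of r "v j"] mult_pos_pos[OF d] by fastforce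
        have "\<not> orient x ?e r \<ge> 0"
        proof
          assume "orient x ?e r \<ge> 0"
          then have 2: "b ?e * g r \<le> g ?e * b r" using low[of ?e r] mult_nonneg_nonneg[OF less_imp_le[OF d]] by fastforce
          have "b ?e * (b r * g (v j)) < b ?e * (g r * b (v j))" using 1 e(2) by simp
          also have "\<dots> = (b ?e * g r) * b (v j)" by simp
          also have "\<dots> \<le> (g ?e * b r) * b (v j)" using 2 j(1) by (intro mult_right_mono) auto
          also have "\<dots> = b r * (g ?e * b (v j))" by simp
          also have "\<dots> \<le> b r * (g (v j) * b ?e)" using least[OF j(1)] r(3) by (intro mult_left_mono)
          finally show False by (simp add: mult_ac)
        qed
        then show ?thesis by auto
      next
        assume "\<exists>s>0. r = s *\<^sub>R v j"
        then obtain s where s: "s > 0" "r = s *\<^sub>R v j" by blast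
        have eq: "orient x ?e r = s * orient x ?e (v j)" using s by simp
        have "d * orient x ?e (v j) \<le> 0" using low[of ?e "v j"] least[OF j(1)] by (simp add: mult_ac)
        then have "orient x ?e (v j) \<le> 0" using d by (simp add: mult_le_0_iff)
        moreover have "v j = ?e" if "orient x ?e (v j) = 0"
        proof -
          have "?e = v j \<or> ?e = - v j" using that by (rule generic_parallel)
          then show ?thesis using e(1) j(1) by (auto simp: a_def)
        qed
        ultimately show ?thesis using s eq by (auto simp: zero_less_mult_iff)
      qed
    qed
    have near: "\<exists>s>0. ?T (?e + s *\<^sub>R w)" for w
    proof -
      have "\<forall>\<^sub>F s in at_right (0::real). a (?e + s *\<^sub>R w) > 0" "\<forall>\<^sub>F s in at_right (0::real). b (?e + s *\<^sub>R w) > 0"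
        "\<forall>\<^sub>F s in at_right (0::real). g (?e + s *\<^sub>R w) > 0"
        unfolding a_def b_def g_def
        by (rule eventually_at_right_pos; use e in \<open>auto simp: a_def b_def g_def intro!: continuous_intros\<close>)+
      with eventually_at_right_less[of "0::real"]
      have "\<forall>\<^sub>F s in at_right (0::real). s > 0 \<and> ?T (?e + s *\<^sub>R w)" by eventually_elim simp
      then show ?thesis using eventually_happens trivial_limit_at_right_real by blast
    qed
    \<comment> \<open>Otherwise the incoming piece would contain points of the triangle at a smaller
      angle than its end. The outgoing piece is treated alike, which gives the fold.\<close>
    have "\<not> right_of k"
    proof
      assume "right_of k"
      then have "orient x ?e (v k) > 0" using orient_swap(3)[of x ?e "v k"] by (simp add: right_of_def)
      moreover obtain s where s: "s > 0" "?T (?e + s *\<^sub>R v k)" using near by blast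
      moreover have "?e + s *\<^sub>R v k \<in> piece k"
        using piece_combination[OF vertex_in_piece(2) vertex_in_piece(1), of 1 s k] s(1) by simp
      ultimately show False using lowest[of "?e + s *\<^sub>R v k" k] by simp
    qed
    moreover have "right_of (Suc k)"
    proof (rule ccontr)
      let ?w = "v (Suc (Suc k))"
      assume "\<not> right_of (Suc k)"
      then have "orient x ?e ?w > 0" using orient_cycle[of ?e ?w x] by (simp add: not_right_of)
      moreover obtain s where s: "s > 0" "?T (?e + s *\<^sub>R ?w)" using near by blast
      moreover have "?e + s *\<^sub>R ?w \<in> piece (Suc k)"
        using piece_combination[OF vertex_in_piece, of 1 s "Suc k"] s(1) by simp
      ultimately show False using lowest[of "?e + s *\<^sub>R ?w" "Suc k"] by simp
    qed
    moreover have "\<alpha> *\<^sub>R x + \<beta> *\<^sub>R ?e \<notin> piece l" if "\<alpha> > 0" "\<beta> > 0" for \<alpha> \<beta> l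
    proof
      let ?r = "\<alpha> *\<^sub>R x + \<beta> *\<^sub>R ?e"
      assume mem: "?r \<in> piece l"
      have "a x = d" "b x = 0" "g x = 0" by (simp_all add: a_def b_def g_def d_def)
      then have r: "a ?r > 0" "b ?r \<ge> 0" "g ?r > 0"
        unfolding lin using mult_pos_pos[OF that(1) d] mult_pos_pos[OF that(2)] e
        by (simp_all add: add_pos_pos less_imp_le)
      then obtain s where s: "?r = s *\<^sub>R ?e" using lowest[OF mem r] by auto
      then have "\<alpha> *\<^sub>R x = (s - \<beta>) *\<^sub>R ?e" by (simp add: algebra_simps)
      then have "orient (\<alpha> *\<^sub>R x) ?e w = 0" for w by simp
      then have "orient x ?e (v k) = 0" using that(1) by simp
      then show False using generic_piece[of k] orient_swap(3)[of x ?e "v k"] by simp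
    qed
    ultimately show False using no_visible_fold[OF e(4)] by blast
  qed
  show ?thesis
    unfolding visible_def
  proof (intro allI impI)
    fix k and \<alpha> \<beta> :: real assume ab: "\<alpha> > 0" "\<beta> \<ge> 0"
    let ?r = "\<alpha> *\<^sub>R x + \<beta> *\<^sub>R (\<gamma>' *\<^sub>R A + \<delta>' *\<^sub>R ?t)"
    show "?r \<notin> piece k"
    proof
      assume mem: "?r \<in> piece k"
      have r: "a ?r = \<alpha> * d" "b ?r = \<beta> * \<gamma>' * d" "g ?r = \<beta> * \<delta>' * d"
        by (simp_all add: a_def b_def g_def d_def)
      show False
      proof (cases "\<beta> * \<delta>' = 0")
        case True
        then have "?r = \<alpha> *\<^sub>R x + (\<beta> * \<gamma>') *\<^sub>R A" by (auto simp: algebra_simps)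
        then show False using mem visA ab nonneg unfolding visible_def by (metis mult_nonneg_nonneg)
      next
        case False
        then have "a ?r > 0" "b ?r \<ge> 0" "g ?r > 0"
          unfolding r using ab nonneg d by auto
        then show False using lower_vertex[OF mem] empty by blast
      qed
    qed
  qed
qed

end

context maximal_point
begin

text \<open>With x on its left, the next piece would start into the triangle x, A, t and hide part
  of the visible stretch from A to t.\<close>

lemma right_of_next:
  assumes right: "right_of (Suc i)"
    and A: "A = \<gamma> *\<^sub>R v (Suc i) + \<delta> *\<^sub>R v (Suc (Suc i))" "\<gamma> > 0"
    and vis: "\<And>\<gamma>' \<delta>'. \<gamma>' \<ge> 0 \<Longrightarrow> \<delta>' \<ge> 0 \<Longrightarrow> visible (\<gamma>' *\<^sub>R A + \<delta>' *\<^sub>R v (Suc (Suc i)))"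
  shows "right_of (Suc (Suc i))"
proof (rule ccontr)
  let ?u = "v (Suc i)" and ?t = "v (Suc (Suc i))" and ?w = "v (Suc (Suc (Suc i)))"
  assume "\<not> right_of (Suc (Suc i))"
  then have L: "orient ?t ?w x > 0" by (simp add: not_right_of)
  have plane: "orient A ?t X = \<gamma> * orient ?u ?t X" for X unfolding A(1) by simp
  have d: "orient x A ?t < 0"
    using right A(2) plane[of x] orient_cycle[of A ?t x]
    unfolding right_of_def by (simp add: mult_pos_neg)
  have "\<forall>\<^sub>F s in at_right (0::real). - orient x A (?t + s *\<^sub>R ?w) > 0"
    using d by (intro eventually_at_right_pos continuous_intros) simp
  then have "\<forall>\<^sub>F s in at_right (0::real). s > 0 \<and> - orient x A (?t + s *\<^sub>R ?w) > 0"
    using eventually_at_right_less[of "0::real"] by eventually_elim simp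
  then obtain s where s: "s > 0" "orient x A (?t + s *\<^sub>R ?w) < 0"
    using eventually_happens trivial_limit_at_right_real by force
  let ?X = "?t + s *\<^sub>R ?w"
  have "orient A ?t ?w < 0" using plane[of ?w] right_turns[of "Suc i"] A(2) by (simp add: mult_pos_neg)
  then have a: "orient ?X A ?t < 0"
    using s(1) orient_cycle[of A ?t ?w] by (simp add: mult_pos_neg)
  have b: "orient x ?X ?t < 0"
    using s(1) L orient_cycle[of ?t ?w x] orient_swap(2)[of x ?w ?t] by simp
  have "(- orient x A ?t) *\<^sub>R ?X = (- orient ?X A ?t) *\<^sub>R x
      + 1 *\<^sub>R ((- orient x ?X ?t) *\<^sub>R A + (- orient x A ?X) *\<^sub>R ?t)"
    using arg_cong[OF orient_cramer[of x A ?t ?X], of uminus] by (simp add: algebra_simps)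
  moreover have "visible ((- orient x ?X ?t) *\<^sub>R A + (- orient x A ?X) *\<^sub>R ?t)"
    by (rule vis) (use b s(2) in simp_all)
  ultimately have "(- orient x A ?t) *\<^sub>R ?X \<notin> piece (Suc (Suc i))"
    using a unfolding visible_def by (metis neg_0_less_iff_less zero_le_one)
  moreover have "?X \<in> piece (Suc (Suc i))"
    using piece_combination[OF vertex_in_piece, of 1 s "Suc (Suc i)"] s(1) by simp
  ultimately show False using piece_scale d by (metis less_imp_le neg_0_less_iff_less)
qed

text \<open>On the way from a point of piece 0 to x, the last point A of the cycle is visible. If
  all pieces through A showed their left side, the potential just behind A would exceed the
  maximum.\<close>

lemma visible_point_exists:
  obtains i A \<gamma> \<delta> where "right_of (Suc i)" "A = \<gamma> *\<^sub>R v (Suc i) + \<delta> *\<^sub>R v (Suc (Suc i))"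
    "\<gamma> > 0" "\<delta> > 0" "visible A"
proof -
  \<comment> \<open>The point ?w is chosen so that no vertex is coplanar with x and ?w; then A is
    interior to every piece through it.\<close>
  have "\<forall>\<^sub>F s in at_right (0::real). s > 0 \<and> orient x (v 0 + s *\<^sub>R v 1) (v j) \<noteq> 0" for j
  proof (cases "orient x (v 0) (v j) = 0")
    case True
    have nz: "orient x (v 1) (v j) \<noteq> 0"
    proof
      assume 1: "orient x (v 1) (v j) = 0"
      have "v 0 = v 1 \<or> v 0 = - v 1"
        using generic_parallel[OF 1] generic_parallel[OF True] by auto
      then show False using generic_piece[of 0] by auto
    qed
    show ?thesis
      using eventually_at_right_less[of "0::real"] by eventually_elim (use True nz in simp)
  next
    case False
    then have "(orient x (v 0) (v j))\<^sup>2 > 0" by simp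
    then have "\<forall>\<^sub>F s in at_right (0::real). (orient x (v 0 + s *\<^sub>R v 1) (v j))\<^sup>2 > 0"
      by (intro eventually_at_right_pos continuous_intros) simp
    then show ?thesis
      using eventually_at_right_less[of "0::real"] by eventually_elim auto
  qed
  then have "\<forall>\<^sub>F s in at_right (0::real). \<forall>j\<in>{..<n}. s > 0 \<and> orient x (v 0 + s *\<^sub>R v 1) (v j) \<noteq> 0"
    by (intro eventually_ball_finite) auto
  then obtain s where s: "\<forall>j\<in>{..<n}. s > 0 \<and> orient x (v 0 + s *\<^sub>R v 1) (v j) \<noteq> 0"
    using eventually_happens trivial_limit_at_right_real by blast
  let ?w = "v 0 + s *\<^sub>R v 1"
  have spos: "s > 0" using s n_pos by blast
  have w_generic: "orient x ?w (v j) \<noteq> 0" for j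
    using s n_pos reduce_index(1)[of j] by (metis lessThan_iff mod_less_divisor)
  \<comment> \<open>Larger parameters are closer to x. Each piece contributes at most one, because x
    is not in its plane.\<close>
  define K where "K = {\<alpha>. \<alpha> \<ge> 0 \<and> (\<exists>k<n. \<alpha> *\<^sub>R x + ?w \<in> piece k)}"
  have "K \<subseteq> (\<lambda>k. - orient (v k) (v (Suc k)) ?w / orient (v k) (v (Suc k)) x) ` {..<n}"
  proof
    fix \<alpha> assume "\<alpha> \<in> K"
    then obtain k where k: "k < n" "\<alpha> *\<^sub>R x + ?w \<in> piece k" by (auto simp: K_def)
    have "orient (v k) (v (Suc k)) (\<alpha> *\<^sub>R x + ?w) = 0" by (rule piece_coplanar[OF k(2) refl])
    then have "\<alpha> * orient (v k) (v (Suc k)) x = - orient (v k) (v (Suc k)) ?w"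
      by (simp only: orient_linear(3,9) add_eq_0_iff2)
    then have "\<alpha> = - orient (v k) (v (Suc k)) ?w / orient (v k) (v (Suc k)) x"
      using generic_piece[of k] by (simp add: eq_divide_eq)
    then show "\<alpha> \<in> (\<lambda>k. - orient (v k) (v (Suc k)) ?w / orient (v k) (v (Suc k)) x) ` {..<n}"
      using k(1) by blast
  qed
  then have finK: "finite K" by (rule finite_subset) simp
  have "?w \<in> piece 0" using piece_combination[OF vertex_in_piece, of 1 s 0] spos by simp
  then have "0 \<in> K" using n_pos by (auto simp: K_def)
  then have "Max K \<in> K" using finK Max_in by blast
  define A where "A = Max K *\<^sub>R x + ?w"
  obtain k0 where k0: "k0 < n" "A \<in> piece k0" using \<open>Max K \<in> K\<close> by (auto simp: K_def A_def)
  have A_generic: "orient x A (v j) \<noteq> 0" for j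
    using w_generic[of j] by (simp add: A_def)
  have vis: "visible A"
    unfolding visible_def
  proof (intro allI impI notI)
    fix k and \<alpha> \<beta> :: real assume ab: "\<alpha> > 0" "\<beta> \<ge> 0" and mem: "\<alpha> *\<^sub>R x + \<beta> *\<^sub>R A \<in> piece k"
    have "\<beta> \<noteq> 0" using mem ab x_notin_piece[of \<alpha> k] by auto
    then have b: "\<beta> > 0" using ab by simp
    have "inverse \<beta> *\<^sub>R (\<alpha> *\<^sub>R x + \<beta> *\<^sub>R A) = (inverse \<beta> * \<alpha>) *\<^sub>R x + A"
      using b by (simp add: scaleR_add_right)
    also have "\<dots> = (inverse \<beta> * \<alpha> + Max K) *\<^sub>R x + ?w"
      by (simp add: A_def scaleR_add_left)
    finally have "inverse \<beta> *\<^sub>R (\<alpha> *\<^sub>R x + \<beta> *\<^sub>R A) = (inverse \<beta> * \<alpha> + Max K) *\<^sub>R x + ?w" .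
    moreover have "inverse \<beta> *\<^sub>R (\<alpha> *\<^sub>R x + \<beta> *\<^sub>R A) \<in> piece (k mod n)"
      using piece_scale[OF mem, of "inverse \<beta>"] b reduce_index[of k] by (simp add: piece_def)
    moreover have "Max K \<ge> 0" using \<open>Max K \<in> K\<close> by (simp add: K_def)
    ultimately have "inverse \<beta> * \<alpha> + Max K \<in> K"
      using b ab n_pos unfolding K_def by (auto intro!: exI[of _ "k mod n"])
    then have "inverse \<beta> * \<alpha> + Max K \<le> Max K" using finK by (intro Max_ge)
    then show False using b ab by (simp add: mult_le_0_iff)
  qed
  have decompose: "\<exists>\<gamma> \<delta>. \<gamma> > 0 \<and> \<delta> > 0 \<and> A = \<gamma> *\<^sub>R v k + \<delta> *\<^sub>R v (Suc k)" if mem: "A \<in> piece k" for k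
  proof -
    obtain \<gamma> \<delta> where c: "\<gamma> \<ge> 0" "\<delta> \<ge> 0" "A = \<gamma> *\<^sub>R v k + \<delta> *\<^sub>R v (Suc k)"
      using mem by (auto simp: piece_def)
    have "\<gamma> \<noteq> 0" using A_generic[of "Suc k"] unfolding c(3) by auto
    moreover have "\<delta> \<noteq> 0" using A_generic[of k] unfolding c(3) by auto
    ultimately show ?thesis using c by (intro exI[of _ \<gamma>] exI[of _ \<delta>]) simp
  qed
  show ?thesis
  proof (cases "\<exists>k. A \<in> piece k \<and> right_of k")
    case True
    then obtain k where k: "A \<in> piece k" "right_of k" by blast
    obtain i where i: "\<tau> (Suc i) = \<tau> k" by (rule predecessor_index)
    then have i': "\<tau> (Suc (Suc i)) = \<tau> (Suc k)" using turn by simp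
    obtain \<gamma> \<delta> where c: "\<gamma> > 0" "\<delta> > 0" "A = \<gamma> *\<^sub>R v k + \<delta> *\<^sub>R v (Suc k)"
      using decompose[OF k(1)] by blast
    show ?thesis
      by (rule that[of i A \<gamma> \<delta>]) (use k(2) c vis i i' in \<open>auto simp: right_of_def\<close>)
  next
    case False
    then have left: "orient (v k) (v (Suc k)) x > 0" if "A \<in> piece k" for k
      using that not_right_of by blast
    have False
    proof (rule no_left_crossing[OF _ k0(1)])
      fix k
      show "\<forall>\<^sub>F \<epsilon> in at_right 0. \<forall>\<^sub>F p in nhds (A + \<epsilon> *\<^sub>R (- x)). crossing x p (v k) (v (Suc k)) \<ge> 0"
      proof (cases "A \<in> piece k")
        case True
        then have "crossing x p (v k) (v (Suc k)) \<ge> 0" for p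
          using left[OF True] by (intro crossing_nonneg) simp
        then show ?thesis by simp
      next
        case False
        then show ?thesis
          using vis unfolding visible_def by (intro crossing_nonneg_near) auto
      qed
    next
      let ?u = "v k0" and ?t = "v (Suc k0)"
      obtain \<gamma> \<delta> where c: "\<gamma> > 0" "\<delta> > 0" "A = \<gamma> *\<^sub>R ?u + \<delta> *\<^sub>R ?t"
        using decompose[OF k0(2)] by blast
      have L: "orient ?u ?t x > 0" using left[OF k0(2)] .
      have "orient x A ?u < 0"
        using L c(2) orient_swap(3)[of x ?t ?u] unfolding c(3) by (simp add: mult_pos_neg)
      then have "\<forall>\<^sub>F \<epsilon> in at_right 0. \<forall>\<^sub>F p in nhds (A + \<epsilon> *\<^sub>R (- x)). orient x p ?u < 0"
        by (intro eventually_nhds_along_ray eventually_nhds_neg continuous_intros)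
      moreover have "orient x A ?t > 0"
        using L c(1) orient_cycle[of ?u ?t x] unfolding c(3) by simp
      then have "\<forall>\<^sub>F \<epsilon> in at_right 0. \<forall>\<^sub>F p in nhds (A + \<epsilon> *\<^sub>R (- x)). orient x p ?t > 0"
        by (intro eventually_nhds_along_ray eventually_nhds_pos continuous_intros)
      moreover have "\<forall>\<^sub>F \<epsilon> in at_right (0::real). \<epsilon> > 0" by (rule eventually_at_right_less)
      ultimately show "\<forall>\<^sub>F \<epsilon> in at_right 0. \<forall>\<^sub>F p in nhds (A + \<epsilon> *\<^sub>R (- x)). crossing x p ?u ?t = 1"
      proof eventually_elim
        case (elim \<epsilon>)
        have "orient ?u ?t (A + \<epsilon> *\<^sub>R (- x)) < 0" using elim(3) L unfolding c(3) by simp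
        then have "\<forall>\<^sub>F p in nhds (A + \<epsilon> *\<^sub>R (- x)). orient ?u ?t p < 0"
          by (intro eventually_nhds_neg continuous_intros)
        with elim(1,2) show ?case
          by eventually_elim (use L in \<open>simp add: crossing_def\<close>)
      qed
    qed
    then show ?thesis ..
  qed
qed

text \<open>Visibility passes to the end of a piece, and the right side to the next piece. The first
  piece is entered at an interior point; afterwards A is a vertex and the previous piece supplies
  \<open>prev\<close>.\<close>

lemma right_of_all: "right_of k"
proof -
  obtain i A \<gamma> \<delta> where A: "right_of (Suc i)" "A = \<gamma> *\<^sub>R v (Suc i) + \<delta> *\<^sub>R v (Suc (Suc i))"
    "\<gamma> > 0" "\<delta> > 0" "visible A"
    by (rule visible_point_exists)
  have vis: "visible (\<gamma>' *\<^sub>R A + \<delta>' *\<^sub>R v (Suc (Suc i)))" if "\<gamma>' \<ge> 0" "\<delta>' \<ge> 0" for \<gamma>' \<delta>'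
    using visible_along_piece[OF A(1-3) _ A(5) _ that] A(4) by simp
  let ?Q = "\<lambda>j. right_of j \<and> right_of (Suc j) \<and> visible (v (Suc j))"
  have "?Q (Suc i + m)" for m
  proof (induction m)
    case 0
    then show ?case
      using A(1) right_of_next[OF A(1-3) vis] vis[of 0 1] by simp
  next
    case (Suc m)
    let ?j = "Suc i + m"
    have eq: "v (Suc ?j) = 1 *\<^sub>R v (Suc ?j) + 0 *\<^sub>R v (Suc (Suc ?j))" by simp
    have vis: "visible (\<gamma>' *\<^sub>R v (Suc ?j) + \<delta>' *\<^sub>R v (Suc (Suc ?j)))" if "\<gamma>' \<ge> 0" "\<delta>' \<ge> 0" for \<gamma>' \<delta>'
      using visible_along_piece[OF _ eq _ _ _ _ that] Suc by simp
    then show ?case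
      using Suc right_of_next[OF _ eq _ vis] vis[of 0 1] by simp
  qed
  \<comment> \<open>Adding \<open>Suc i\<close> periods moves the index k past the start of the
    induction.\<close>
  moreover have "Suc i * 1 \<le> Suc i * n" using n_pos by (intro mult_le_mono2) simp
  then have "Suc i \<le> k + Suc i * n" by simp
  then obtain m where "k + Suc i * n = Suc i + m" using le_iff_add by blast
  ultimately have "right_of (k + Suc i * n)" by metis
  moreover have "\<tau> (k + Suc i * n) = \<tau> k" "\<tau> (Suc (k + Suc i * n)) = \<tau> (Suc k)"
    using closed_walk_shift[OF closed, of k "Suc i"] closed_walk_shift[OF closed, of "Suc k" "Suc i"] by simp_all
  ultimately show ?thesis unfolding right_of_def by simp
qed

end

section \<open>From right-turning cycles to swirls\<close>

context right_cycle
begin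

text \<open>An arc traversed both ways would have x on the right of both directions.\<close>

lemma arcs_distinct:
  assumes "fst (\<tau> i) = fst (\<tau> j)"
  shows "\<tau> i = \<tau> j"
proof -
  obtain x where x: "\<And>i j. cross3 (v i) (v j) \<noteq> 0 \<Longrightarrow> orient (v i) (v j) x \<noteq> 0"
    "\<And>P q. \<forall>\<^sub>F p in nhds q. P p \<Longrightarrow> \<exists>p. P p \<and> net_crossing \<tau> n x p \<le> 0"
    by (rule maximal_point_exists[OF closed]) blast
  interpret maximal_point D \<tau> n x
    by unfold_locales (use x in auto)
  have side: "orient (source (\<tau> i)) (v i) x < 0" for i
  proof -
    obtain k where k: "\<tau> (Suc k) = \<tau> i" by (rule predecessor_index)
    obtain l where "l > 0" "\<And>X. orient (v k) (v (Suc k)) X = l * orient (source (\<tau> (Suc k))) (v (Suc k)) X"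
      using source_direction[OF state, of "v k" "Suc k"] piece_arc(3)[of k] by (auto simp: piece_arc_def)
    then show ?thesis using right_of_all[of k] k by (simp add: right_of_def mult_less_0_iff)
  qed
  have "v i = v j"
  proof (rule ccontr)
    assume ne: "v i \<noteq> v j"
    have "v j \<in> endpoints (fst (\<tau> i))" using statesD(2)[OF state[of j]] assms by simp
    from other_end_other_end[OF statesD(3)[OF state] statesD(2)[OF state] this ne]
    have "source (\<tau> j) = v i" "source (\<tau> i) = v j" using assms by (simp_all add: source_def)
    then show False using side[of i] side[of j] orient_swap(1)[of "v j" "v i" x] by simp
  qed
  with assms show ?thesis by (simp add: prod_eq_iff)
qed

definition cycle_arcs :: "arc list" where
  "cycle_arcs = map (\<lambda>i. fst (\<tau> i)) [0..<n]"

lemma cycle_arcs_nth: "cycle_arcs ! (i mod n) = fst (\<tau> i)"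
  using n_pos reduce_index(1)[of i] by (simp add: cycle_arcs_def)

lemma cycle_clockwise:
  assumes "inj_on \<tau> {..<n}"
  shows "clockwise_swirl D cycle_arcs"
  unfolding clockwise_swirl_def swirl_with_def
proof (intro conjI exI[of _ v] allI impI)
  have len: "length cycle_arcs = n" by (simp add: cycle_arcs_def)
  show "cycle_arcs \<noteq> []" using n_pos len by auto
  show "set cycle_arcs \<subseteq> D" using walkD(1)[OF walk] by (auto simp: cycle_arcs_def)
  show "distinct cycle_arcs"
    using assms arcs_distinct by (auto simp: cycle_arcs_def distinct_map inj_on_def lessThan_atLeast0)
  fix i assume "i < length cycle_arcs"
  then have i: "i < n" using len by simp
  show "v i \<in> endpoints (cycle_arcs ! i)" using i cycle_arcs_nth[of i] walkD(2)[OF walk] by simp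
  have "sgn (v i) \<in> arc_relint (fst (\<tau> (Suc i)))"
    using sgn_arc_cone walkD(3)[OF walk] by blast
  then show "v i \<in> arc_relint (cycle_arcs ! ((i + 1) mod length cycle_arcs))"
    using cycle_arcs_nth[of "Suc i"] v_norm[of i] by (simp add: len sgn_div_norm)
  have "\<tau> ((i + n - 1) mod n) = \<tau> (i + n - 1)" "\<tau> ((i + 1) mod n) = \<tau> (i + 1)"
    using reduce_index(1) by blast+
  moreover have "\<tau> (Suc (i + n - 1)) = \<tau> i" "\<tau> (Suc (Suc (i + n - 1))) = \<tau> (i + 1)"
    using n_pos closed_walk_shift[OF closed, of i 1] closed_walk_shift[OF closed, of "Suc i" 1] by simp_all
  ultimately show "orient (v ((i + length cycle_arcs - 1) mod length cycle_arcs)) (v i) (v ((i + 1) mod length cycle_arcs)) < 0"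
    using right_turns[of "i + n - 1"] by (simp only: len)
qed

end

context diagram
begin

lemma right_cycle_exists:
  assumes "\<rho> \<in> states"
  obtains k n where "right_cycle D (\<lambda>i. (right_turn ^^ i) ((right_turn ^^ k) \<rho>)) n"
    "inj_on (\<lambda>i. (right_turn ^^ i) ((right_turn ^^ k) \<rho>)) {..<n}"
proof -
  obtain k n where "closed_walk (\<lambda>i. (right_turn ^^ i) ((right_turn ^^ k) \<rho>)) n"
    "inj_on (\<lambda>i. (right_turn ^^ i) ((right_turn ^^ k) \<rho>)) {..<n}"
    by (rule eventual_closed_walk[OF assms right_turn(1,2)])
  with that show ?thesis by (simp add: right_cycle_def right_cycle_axioms_def diagram_axioms)
qed

lemma two_clockwise_swirls:
  "\<exists>s1 s2. clockwise_swirl D s1 \<and> clockwise_swirl D s2 \<and> \<not> same_cycle s1 s2"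
proof -
  obtain a where "a \<in> D" using D_nonempty by blast
  then have "(a, fst a) \<in> states" by (simp add: states_def endpoints_def)
  then obtain k1 n1 where c1: "right_cycle D (\<lambda>i. (right_turn ^^ i) ((right_turn ^^ k1) (a, fst a))) n1"
    "inj_on (\<lambda>i. (right_turn ^^ i) ((right_turn ^^ k1) (a, fst a))) {..<n1}"
    by (rule right_cycle_exists)
  define \<tau>1 where "\<tau>1 = (\<lambda>i. (right_turn ^^ i) ((right_turn ^^ k1) (a, fst a)))"
  interpret C1: right_cycle D \<tau>1 n1 using c1(1) unfolding \<tau>1_def .
  obtain \<rho> where \<rho>: "\<rho> \<in> states" "\<And>i. (right_turn ^^ Suc i) \<rho> \<noteq> \<tau>1 0"
    by (rule right_turns_avoid_state[OF C1.state[of 0]]) blast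
  from \<rho>(1) obtain k2 n2 where c2: "right_cycle D (\<lambda>i. (right_turn ^^ i) ((right_turn ^^ k2) \<rho>)) n2"
    "inj_on (\<lambda>i. (right_turn ^^ i) ((right_turn ^^ k2) \<rho>)) {..<n2}"
    by (rule right_cycle_exists)
  define \<tau>2 where "\<tau>2 = (\<lambda>i. (right_turn ^^ i) ((right_turn ^^ k2) \<rho>))"
  interpret C2: right_cycle D \<tau>2 n2 using c2(1) unfolding \<tau>2_def .
  \<comment> \<open>A full period is added to make the iterate positive.\<close>
  have avoid: "\<tau>2 i \<noteq> \<tau>1 0" for i
  proof -
    have "\<tau>2 i = \<tau>2 (i + n2)" using C2.closed by (simp add: closed_walk_def)
    also have "i + n2 = Suc (i + n2 - 1)" using C2.n_pos by simp
    also have "\<tau>2 \<dots> = (right_turn ^^ Suc (i + n2 - 1 + k2)) \<rho>"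
      unfolding \<tau>2_def by (simp add: funpow_add)
    finally show ?thesis using \<rho>(2) by simp
  qed
  have "\<not> same_cycle C1.cycle_arcs C2.cycle_arcs"
  proof
    assume "same_cycle C1.cycle_arcs C2.cycle_arcs"
    then obtain k where k: "C2.cycle_arcs = rotate k C1.cycle_arcs" by (auto simp: same_cycle_def)
    then have "length C2.cycle_arcs = length C1.cycle_arcs" by simp
    then have n: "n2 = n1" by (simp add: C1.cycle_arcs_def C2.cycle_arcs_def)
    have rot: "fst (\<tau>2 j) = fst (\<tau>1 (k + j))" for j
    proof -
      have "fst (\<tau>2 j) = rotate k C1.cycle_arcs ! (j mod n1)"
        using C2.cycle_arcs_nth[of j] n k by simp
      also have "\<dots> = C1.cycle_arcs ! ((k + j mod n1) mod n1)"
        using C1.n_pos by (subst nth_rotate) (simp_all add: C1.cycle_arcs_def)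
      also have "\<dots> = fst (\<tau>1 (k + j))"
        using C1.cycle_arcs_nth[of "k + j"] by (simp add: mod_add_right_eq)
      finally show ?thesis .
    qed
    \<comment> \<open>Chosen so that k + j is a multiple of the period, which undoes the
      rotation.\<close>
    define j where "j = k * (n1 - 1)"
    have j: "k + j = 0 + k * n1" using C1.n_pos by (cases n1) (auto simp: j_def)
    have 0: "fst (\<tau>2 j) = fst (\<tau>1 0)"
      using rot[of j] closed_walk_shift[OF C1.closed, of 0 k] j by simp
    have "k + Suc j = 1 + k * n1" using j by simp
    then have 1: "fst (\<tau>2 (Suc j)) = fst (\<tau>1 (Suc 0))"
      using rot[of "Suc j"] closed_walk_shift[OF C1.closed, of 1 k] by simp
    \<comment> \<open>The states share their arc but not their head. Both ends of this arc then lie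
      inside the common next arc, against transversality.\<close>
    have ne: "snd (\<tau>1 0) \<noteq> snd (\<tau>2 j)"
      using avoid[of j] 0 by (simp add: prod_eq_iff)
    note st1 = statesD[OF C1.state[of 0]] and st2 = statesD[OF C2.state[of j]]
    have "snd (\<tau>1 0) = other_end (fst (\<tau>2 j)) (snd (\<tau>2 j))"
      using other_end_other_end(1)[OF st2(3) _ st2(2) ne] st1(2) 0 by simp
    moreover have "snd (\<tau>1 0) \<in> arc_cone (fst (\<tau>2 (Suc j)))"
      using walkD(3)[OF C1.walk, of 0] 1 by simp
    ultimately show False
      using blocker_transversal[OF st2(1,2) walkD(1)[OF C2.walk] walkD(3)[OF C2.walk]] orient_arc_cone_0
      by metis
  qed
  moreover have "clockwise_swirl D C1.cycle_arcs" "clockwise_swirl D C2.cycle_arcs"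
    using C1.cycle_clockwise C2.cycle_clockwise c1(2) c2(2) by (simp_all add: \<tau>1_def \<tau>2_def)
  ultimately show ?thesis by blast
qed

end

subsection \<open>Counterclockwise swirls\<close>

text \<open>The point reflection preserves incidences and exchanges the two senses of turning, as
  \<open>orient\<close> is odd in each of its three arguments.\<close>

definition antipodal_arc :: "arc \<Rightarrow> arc" where
  "antipodal_arc a = (- fst a, - snd a)"

lemma antipodal_arc_simps [simp]:
  "antipodal_arc (antipodal_arc a) = a" "endpoints (antipodal_arc a) = uminus ` endpoints a"
  by (simp_all add: antipodal_arc_def endpoints_def)

lemma antipodal_arc_relint [simp]: "arc_relint (antipodal_arc a) = uminus ` arc_relint a"
proof -
  have "sgn ((1 - t) *\<^sub>R (- p) + t *\<^sub>R (- q)) = - sgn ((1 - t) *\<^sub>R p + t *\<^sub>R q)" for t and p q :: point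
    by (simp flip: sgn_minus)
  then show ?thesis by (auto simp: arc_relint_def antipodal_arc_def image_iff)
qed

lemma antipodal_diagram:
  assumes "spherical_diagram D"
  shows "spherical_diagram (antipodal_arc ` D)"
  unfolding spherical_diagram_def
proof (intro conjI ballI impI)
  show "finite (antipodal_arc ` D)" "antipodal_arc ` D \<noteq> {}"
    using assms by (auto simp: spherical_diagram_def)
next
  fix a assume "a \<in> antipodal_arc ` D"
  then obtain a' where "a' \<in> D" "a = antipodal_arc a'" by blast
  moreover from this have "is_arc a'" using assms by (simp add: spherical_diagram_def)
  ultimately show "is_arc a"
    unfolding is_arc_def on_sphere_def antipodal_arc_def by (metis fst_conv snd_conv minus_minus norm_minus_cancel)
next
  fix a b assume "a \<in> antipodal_arc ` D" "b \<in> antipodal_arc ` D" "a \<noteq> b"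
  then obtain a' b' where "a' \<in> D" "b' \<in> D" "a = antipodal_arc a'" "b = antipodal_arc b'" "a' \<noteq> b'" by blast
  moreover from this have "arc_relint a' \<inter> arc_relint b' = {}"
    using assms by (simp add: spherical_diagram_def)
  ultimately show "arc_relint a \<inter> arc_relint b = {}" by auto
next
  fix b e assume "b \<in> antipodal_arc ` D" "e \<in> endpoints b"
  then obtain b' e' where "b' \<in> D" "e' \<in> endpoints b'" "e = - e'" by auto
  moreover from this obtain a where "a \<in> D" "e' \<in> arc_relint a"
    using assms unfolding spherical_diagram_def by blast
  ultimately show "\<exists>a\<in>antipodal_arc ` D. e \<in> arc_relint a" by auto
qed

lemma antipodal_clockwise:
  assumes "clockwise_swirl (antipodal_arc ` D) s"
  shows "counterclockwise_swirl D (map antipodal_arc s)"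
proof -
  obtain e where e: "\<And>i. i < length s \<Longrightarrow> e i \<in> endpoints (s ! i)"
      "\<And>i. i < length s \<Longrightarrow> e i \<in> arc_relint (s ! ((i + 1) mod length s))"
      "\<And>i. i < length s \<Longrightarrow> orient (e ((i + length s - 1) mod length s)) (e i) (e ((i + 1) mod length s)) < 0"
    and s: "s \<noteq> []" "set s \<subseteq> antipodal_arc ` D" "distinct s"
    using assms unfolding clockwise_swirl_def swirl_with_def by blast
  show ?thesis
    unfolding counterclockwise_swirl_def swirl_with_def
  proof (intro conjI exI[of _ "\<lambda>i. - e i"] allI impI)
    show "map antipodal_arc s \<noteq> []" using s by simp
    show "set (map antipodal_arc s) \<subseteq> D" using s(2) by auto
    show "distinct (map antipodal_arc s)"
      using s(3) by (auto simp: distinct_map intro: inj_on_inverseI[of _ antipodal_arc])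
    fix i assume "i < length (map antipodal_arc s)"
    then have i: "i < length s" by simp
    then have i': "(i + 1) mod length s < length s" by (intro mod_less_divisor) auto
    show "- e i \<in> endpoints (map antipodal_arc s ! i)" using e(1)[OF i] i by simp
    show "- e i \<in> arc_relint (map antipodal_arc s ! ((i + 1) mod length (map antipodal_arc s)))"
      using e(2)[OF i] i' by simp
    show "orient (- e ((i + length (map antipodal_arc s) - 1) mod length (map antipodal_arc s))) (- e i)
       (- e ((i + 1) mod length (map antipodal_arc s))) > 0"
      using e(3)[OF i] by simp
  qed
qed

theorem mainTheorem1:
  assumes "spherical_diagram D"
  shows "(\<exists>s1 s2. clockwise_swirl D s1 \<and> clockwise_swirl D s2 \<and> \<not> same_cycle s1 s2) \<and>
         (\<exists>s1 s2. counterclockwise_swirl D s1 \<and> counterclockwise_swirl D s2 \<and> \<not> same_cycle s1 s2)"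
proof
  interpret diagram D using assms by unfold_locales
  show "\<exists>s1 s2. clockwise_swirl D s1 \<and> clockwise_swirl D s2 \<and> \<not> same_cycle s1 s2"
    by (rule two_clockwise_swirls)
next
  interpret diagram "antipodal_arc ` D" using antipodal_diagram[OF assms] by unfold_locales
  obtain s1 s2 where s: "clockwise_swirl (antipodal_arc ` D) s1" "clockwise_swirl (antipodal_arc ` D) s2"
    "\<not> same_cycle s1 s2"
    using two_clockwise_swirls by blast
  have "\<not> same_cycle (map antipodal_arc s1) (map antipodal_arc s2)"
  proof
    assume "same_cycle (map antipodal_arc s1) (map antipodal_arc s2)"
    then obtain k where "map antipodal_arc s2 = map antipodal_arc (rotate k s1)"
      by (auto simp: same_cycle_def rotate_map)
    then have "s2 = rotate k s1"
      by (rule map_injective) (rule inj_on_inverseI[of _ antipodal_arc], simp)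
    then show False using s(3) by (auto simp: same_cycle_def)
  qed
  then show "\<exists>s1 s2. counterclockwise_swirl D s1 \<and> counterclockwise_swirl D s2 \<and> \<not> same_cycle s1 s2"
    using antipodal_clockwise[OF s(1)] antipodal_clockwise[OF s(2)] by blast
qed

end
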